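(* For all $n \ge 0$, $$ A_n^{\mathrm{maj},\mathrm{exc}, \mathrm{fix}}(q,t,r) = r^n + \sum_{k=0}^{n-2} \left[\begin{array}{c} n \\k\end{array}\right]_q A_k^{\mathrm{maj},\mathrm{exc},\mathrm{fix}}(q,t,r) \,tq\,[n-k-1]_{tq},$$ and $$A_n^{\mathrm{maj},\mathrm{exc}, \mathrm{fix}}(q,t,r) = \sum_{m = 0}^{\lfloor n/2 \rfloor}\ \sum_{\substack{k_0\ge 0,\ k_1,\dots, k_m \ge 2 \\ k_0+k_1+\cdots+k_m = n}} \left[\begin{array}{c} n \\k_0,\dots,k_m\end{array}\right]_q r^{k_0} \prod_{i=1}^m tq\,[k_i-1]_{tq}.$$
   Context: For $n\ge 1$ let $\mathfrak S_n$ be the symmetric group on $[n]=\{1,\dots,n\}$, and write $\sigma=\sigma_1\cdots\sigma_n$ with $\sigma_i=\sigma(i)$. Put $\mathrm{DES}(\sigma)=\{i\in[n-1]:\sigma_i>\sigma_{i+1}\}$, $\mathrm{maj}(\sigma)=\sum_{i\in \mathrm{DES}(\sigma)} i$, $\mathrm{exc}(\sigma)=|\{i\in[n-1]:\sigma_i>i\}|$, and let $\mathrm{fix}(\sigma)$ be the number of fixed points. $A_n^{\mathrm{maj},\mathrm{exc},\mathrm{fix}}(q,t,r)=\sum_{\sigma\in\mathfrak S_n}q^{\mathrm{maj}(\sigma)}t^{\mathrm{exc}(\sigma)}r^{\mathrm{fix}(\sigma)}$ for $n\ge1$, and $A_0^{\mathrm{maj},\mathrm{exc},\mathrm{fix}}=1$.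 For any indeterminate or expression $u$, $[m]_u=1+u+\cdots+u^{m-1}$ and $[0]_u=0$; $[m]_q!=\prod_{j=1}^m[j]_q$, $[0]_q!=1$. Further $\left[\begin{smallmatrix}n\\k\end{smallmatrix}\right]_q=\frac{[n]_q!}{[k]_q![n-k]_q!}$ and $\left[\begin{smallmatrix}n\\k_0,\dots,k_m\end{smallmatrix}\right]_q=\frac{[n]_q!}{[k_0]_q![k_1]_q!\cdots[k_m]_q!}$. *)

theory Defs
  imports "HOL-Computational_Algebra.Polynomial" "HOL-Combinatorics.Permutations"
begin

section \<open>Permutation statistics\<close>

text \<open>
  A permutation of \<open>{1..n}\<close> is a function \<open>\<sigma> :: nat \<Rightarrow> nat\<close> with \<^term>\<open>\<sigma> permutes {1..n}\<close>; it is the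
  identity outside \<open>{1..n}\<close>, so the statistics carry \<open>n\<close> explicitly.
\<close>

definition DES :: "nat \<Rightarrow> (nat \<Rightarrow> nat) \<Rightarrow> nat set" where
  "DES n \<sigma> = {i \<in> {1..<n}. \<sigma> i > \<sigma> (i + 1)}"

definition maj :: "nat \<Rightarrow> (nat \<Rightarrow> nat) \<Rightarrow> nat" where
  "maj n \<sigma> = (\<Sum>i\<in>DES n \<sigma>. i)"

definition exc :: "nat \<Rightarrow> (nat \<Rightarrow> nat) \<Rightarrow> nat" where
  "exc n \<sigma> = card {i \<in> {1..<n}. \<sigma> i > i}"

definition fixpts :: "nat \<Rightarrow> (nat \<Rightarrow> nat) \<Rightarrow> nat" where
  "fixpts n \<sigma> = card {i \<in> {1..n}. \<sigma> i = i}"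

definition A_maj_exc_fix :: "nat \<Rightarrow> 'a \<Rightarrow> 'a \<Rightarrow> 'a \<Rightarrow> 'a::comm_semiring_1" where
  "A_maj_exc_fix n q t r = (\<Sum>\<sigma> | \<sigma> permutes {1..n}. q ^ maj n \<sigma> * t ^ exc n \<sigma> * r ^ fixpts n \<sigma>)"

lemma A_maj_exc_fix_0: "A_maj_exc_fix 0 q t r = 1"
  by (simp add: A_maj_exc_fix_def maj_def DES_def exc_def fixpts_def)

section \<open>q-analogues\<close>

definition qint :: "'a \<Rightarrow> nat \<Rightarrow> 'a::comm_semiring_1" where
  "qint u m = (\<Sum>i<m. u ^ i)"

definition qfact :: "'a \<Rightarrow> nat \<Rightarrow> 'a::comm_semiring_1" where
  "qfact u m = (\<Prod>j=1..m. qint u j)"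

text \<open>
  The quotients below are taken with the ring division \<^term>\<open>(div)\<close>. At the indeterminate \<open>q\<close> they are
  exact, with nonzero denominator; see \<open>qbinomial_exact\<close> and \<open>qmultinomial_exact\<close> below.
\<close>

definition qbinomial :: "'a \<Rightarrow> nat \<Rightarrow> nat \<Rightarrow> 'a::idom_divide" where
  "qbinomial u n k = qfact u n div (qfact u k * qfact u (n - k))"

definition qmultinomial :: "'a \<Rightarrow> nat \<Rightarrow> nat list \<Rightarrow> 'a::idom_divide" where
  "qmultinomial u n ks = qfact u n div (\<Prod>k\<leftarrow>ks. qfact u k)"

text \<open>The tuples \<open>(k\<^sub>0, \<dots>, k\<^sub>m)\<close>, as lists of length \<open>m + 1\<close>; only \<open>k\<^sub>0\<close> may be less than 2.\<close>

definition comps :: "nat \<Rightarrow> nat \<Rightarrow> nat list set" where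
  "comps n m = {ks. length ks = m + 1 \<and> (\<forall>i\<in>{1..m}. ks ! i \<ge> 2) \<and> sum_list ks = n}"

lemma finite_comps: "finite (comps n m)"
proof (rule finite_subset)
  show "comps n m \<subseteq> {ks. set ks \<subseteq> {..n} \<and> length ks = m + 1}"
    by (auto simp: comps_def member_le_sum_list)
qed (simp add: finite_lists_length_eq)

section \<open>The indeterminates of \<open>\<int>[q][t][r]\<close>\<close>

definition Xq :: "int poly poly poly" where "Xq = [:[:[:0, 1:]:]:]"
definition Xt :: "int poly poly poly" where "Xt = [:[:0, 1:]:]"
definition Xr :: "int poly poly poly" where "Xr = [:0, 1:]"

section \<open>Exactness of the quotients\<close>

lemma qint_add: "qint u (a + b) = qint u a + u ^ a * qint u b"
  by (induction b) (simp_all add: qint_def power_add algebra_simps)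

lemma qfact_0 [simp]: "qfact u 0 = 1"
  by (simp add: qfact_def)

lemma qfact_Suc: "qfact u (Suc m) = qint u (Suc m) * qfact u m"
  by (simp add: qfact_def mult.commute)

lemma qfact_mult_dvd: "qfact u a * qfact u b dvd qfact u (a + b)"
proof (induction "a + b" arbitrary: a b)
  case (Suc n)
  show ?case
  proof (cases "a = 0 \<or> b = 0")
    case False
    then obtain a' b' where ab: "a = Suc a'" "b = Suc b'"
      by (metis not0_implies_Suc)
    have "qfact u a' * qfact u b dvd qfact u n" "qfact u a * qfact u b' dvd qfact u n"
      using Suc.hyps(1)[of a' b] Suc.hyps(1)[of a b'] Suc.hyps(2) ab by simp_all
    then have "qint u a * (qfact u a' * qfact u b) dvd qint u a * qfact u n"
      and "qint u b * (qfact u a * qfact u b') dvd u ^ a * qint u b * qfact u n"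
      by (auto intro: mult_dvd_mono)
    moreover have "qfact u (a + b) = qint u a * qfact u n + u ^ a * qint u b * qfact u n"
      by (metis Suc.hyps(2) qfact_Suc qint_add distrib_right)
    ultimately show ?thesis
      by (simp add: ab qfact_Suc mult_ac)
  qed auto
qed simp

lemma prod_list_qfact_dvd: "(\<Prod>k\<leftarrow>ks. qfact u k) dvd qfact u (sum_list ks)"
proof (induction ks)
  case (Cons k ks)
  then show ?case
    using dvd_trans[OF mult_dvd_mono[OF dvd_refl Cons] qfact_mult_dvd] by simp
qed simp

lemma qfact_Xq_nonzero: "qfact Xq m \<noteq> 0"
proof -
  have "poly (poly (poly (qint Xq j) 0) 0) 1 = int j" for j
    by (simp add: qint_def Xq_def poly_sum)
  then have "qint Xq j \<noteq> 0" if "j > 0" for j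
    using that by (metis of_nat_0_eq_iff poly_0 less_irrefl)
  then show ?thesis
    by (simp add: qfact_def)
qed

lemma qbinomial_exact:
  assumes "k \<le> n"
  shows "qbinomial Xq n k * (qfact Xq k * qfact Xq (n - k)) = qfact Xq n"
  using qfact_mult_dvd[of Xq k "n - k"] assms by (simp add: qbinomial_def)

lemma qmultinomial_exact:
  assumes "sum_list ks = n"
  shows "qmultinomial Xq n ks * (\<Prod>k\<leftarrow>ks. qfact Xq k) = qfact Xq n"
  using prod_list_qfact_dvd[of Xq ks] assms by (simp add: qmultinomial_def)

end

theory Submission
  imports Defs "HOL-Computational_Algebra.Formal_Power_Series"
    "HOL-Computational_Algebra.Polynomial_Factorial"
begin

text \<open>
  The first formula is equivalent to a generating function identity. With \<open>H(s) = (\<Sum>n. s ^ n * X ^ n / (q; q)_n)\<close>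
  and \<open>u = t q\<close> it says that the series with coefficients \<open>A_n / (q; q)_n\<close> equals
  \<open>(1 - u) H(r) / (H(u) - u H(1))\<close>; clearing the denominator and comparing coefficients gives the
  recurrence (\<open>sum_word_weight_recurrence\<close>). The second formula is the iterated recurrence
  (\<open>A_maj_exc_fix_eq_comps_sum\<close>).

  To find the series, put a bar on each excedance value and order barred letters before unbarred
  ones. The major index of the barred word is \<open>maj - exc\<close> (\<open>word_maj_eq\<close>). As for any major index,
  \<open>q ^ maj / (q; q)_n\<close> is the sum of \<open>q ^ (\<Sum>i. f i)\<close> over the weakly decreasing sequences \<open>f\<close> of natural
  numbers that drop at each descent. The places where \<open>f = 0\<close> are final and free of barred descents;
  hence they consist of a block of increasing excedances, followed by a block of increasing
  antiexcedances and by fixed points (\<open>peel_stage\<close>). Cutting off these blocks and lowering \<open>f\<close> by one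
  on the remaining \<open>N\<close> places, at the cost of \<open>q ^ N\<close>, is a recursion on partial permutations: words of
  length \<open>N\<close> that miss some values below \<open>N\<close> and use a set \<open>S\<close> of values from \<open>N\<close> on instead.

  The number of ways to add a block depends on the partial permutation only through \<open>S\<close>
  (\<open>card_extensions\<close>). Moreover, if the weight of the partial permutations with set \<open>S\<close> is the
  coefficient of \<open>X ^ N\<close> in \<open>G p ^ |S|\<close>, then this remains so after adding a block, with
  \<open>p\<close> transformed by a fractional linear map and \<open>G\<close> multiplied by an explicit series
  (\<open>block_transfer_exc\<close>, \<open>block_transfer_antiexc\<close>,
  \<open>block_transfer_fix\<close>). Adding all three blocks after the substitution \<open>X \<mapsto> q X\<close> must reproduce
  \<open>(G, p)\<close>. Since \<open>H(s)(q X) = (1 - s X) H(s)\<close>, this fixed point equation is solved by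
  \<open>1 + p = (1 - u) H(u) / (H(u) - u H(1))\<close> and \<open>G = (1 - u) H(r) / (H(u) - u H(1))\<close>, and the recursion
  has only one solution (\<open>block_transfer_cycle_unique\<close>), since the weights of length \<open>N\<close> enter it with
  coefficient \<open>1 - q ^ N\<close>. Permutations are the case \<open>S = {}\<close>.
\<close>

section \<open>Words, barred descents and their weights\<close>

text \<open>
  Places and values are numbered from \<open>0\<close>: the word \<open>xs\<close> stands for the permutation sending
  \<open>i + 1\<close> to \<open>xs ! i + 1\<close>. The kinds are excedance (\<open>0\<close>), strict antiexcedance (\<open>1\<close>) and fixed
  point (\<open>2\<close>). Their numerical order is the order in which they must occur on a stretch of places
  without a barred descent.
\<close>

definition kind :: "nat \<Rightarrow> nat \<Rightarrow> nat" where
  "kind i v = (if i < v then 0 else if v < i then 1 else 2)"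

text \<open>
  Write an excedance value with a bar and let the barred letters precede the unbarred ones. Then
  \<open>barred_descent xs i\<close> is a descent of the barred word between places \<open>i - 1\<close> and \<open>i\<close>. Comparing
  kinds first is right among unbarred letters too: in a word without repetitions, a fixed point is
  followed by a smaller value if an antiexcedance comes next, and an antiexcedance by a larger value
  if a fixed point comes next. \<open>dexsum\<close> is the major index of the barred word.
\<close>

definition barred_descent :: "nat list \<Rightarrow> nat \<Rightarrow> bool" where
  "barred_descent xs i \<longleftrightarrow> 0 < i \<and>
     (kind i (xs ! i) < kind (i - 1) (xs ! (i - 1)) \<or>
      kind i (xs ! i) = kind (i - 1) (xs ! (i - 1)) \<and> xs ! i < xs ! (i - 1))"

definition dexsum :: "nat list \<Rightarrow> nat" where
  "dexsum xs = (\<Sum>i<length xs. if barred_descent xs i then i else 0)"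

definition qpoch :: "'a::comm_ring_1 \<Rightarrow> nat \<Rightarrow> 'a" where
  "qpoch q n = (\<Prod>i=1..n. 1 - q ^ i)"

definition kind_weight :: "(nat \<Rightarrow> 'a::comm_monoid_mult) \<Rightarrow> nat list \<Rightarrow> 'a" where
  "kind_weight c xs = (\<Prod>i<length xs. c (kind i (xs ! i)))"

text \<open>
  Let \<open>f\<close> run over the weakly decreasing sequences of natural numbers indexed by the places of
  \<open>xs\<close> that decrease strictly at each barred descent. The sum of \<open>q ^ (\<Sum>i. f i)\<close> over all of them
  is \<open>q ^ dexsum xs / qpoch q (length xs)\<close>. Thus \<open>word_weight\<close> is the total weight of the pairs \<open>(xs, f)\<close>, and the
  relations among weights below are statements on the places where \<open>f\<close> vanishes. Working with the
  closed fraction avoids infinite sums over \<open>f\<close>.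
\<close>

definition word_weight :: "'a::field \<Rightarrow> (nat \<Rightarrow> 'a) \<Rightarrow> nat list \<Rightarrow> 'a" where
  "word_weight q c xs = q ^ dexsum xs * kind_weight c xs / qpoch q (length xs)"

definition last_kind :: "nat list \<Rightarrow> nat" where
  "last_kind xs = kind (length xs - 1) (last xs)"

lemma qpoch_Suc: "qpoch q (Suc n) = (1 - q ^ Suc n) * qpoch q n"
  by (simp add: qpoch_def mult.commute)

lemma qpoch_nonzero:
  fixes q :: "'a::idom"
  assumes "\<And>i. i > 0 \<Longrightarrow> q ^ i \<noteq> 1"
  shows "qpoch q n \<noteq> 0"
  using assms by (force simp: qpoch_def)

lemma dexsum_snoc:
  "dexsum (xs @ [v]) = dexsum xs +
     (if xs \<noteq> [] \<and> (kind (length xs) v < last_kind xs \<or>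
                      kind (length xs) v = last_kind xs \<and> v < last xs)
      then length xs else 0)"
proof -
  have "barred_descent (xs @ [v]) i = barred_descent xs i" if "i < length xs" for i
    using that by (auto simp: barred_descent_def nth_append)
  moreover have "barred_descent (xs @ [v]) (length xs) \<longleftrightarrow>
      xs \<noteq> [] \<and> (kind (length xs) v < last_kind xs \<or> kind (length xs) v = last_kind xs \<and> v < last xs)"
    by (auto simp: barred_descent_def nth_append last_kind_def last_conv_nth)
  ultimately show ?thesis
    by (simp add: dexsum_def)
qed

lemma kind_weight_snoc: "kind_weight c (xs @ [v]) = kind_weight c xs * c (kind (length xs) v)"
  by (simp add: kind_weight_def nth_append)

text \<open>
  In terms of the sequences \<open>f\<close>, \<open>stage q c j xs\<close> is the total weight of those whose zeros lie on
  places of kind less than \<open>j\<close>. The zeros form a final stretch without barred descents, on which kinds increase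
  weakly; so if the last kind is less than \<open>j\<close> there is no restriction, and otherwise \<open>f\<close> has no
  zero at all, which costs a factor \<open>q\<close> at each place.
\<close>

definition stage :: "'a::field \<Rightarrow> (nat \<Rightarrow> 'a) \<Rightarrow> nat \<Rightarrow> nat list \<Rightarrow> 'a" where
  "stage q c j xs =
     (if xs = [] \<or> last_kind xs < j then word_weight q c xs else q ^ length xs * word_weight q c xs)"

lemma stage_0: "stage q c 0 xs = q ^ length xs * word_weight q c xs"
  by (simp add: stage_def)

lemma stage_3: "stage q c 3 xs = word_weight q c xs"
  by (simp add: stage_def last_kind_def kind_def)

text \<open>
  The places where a sequence \<open>f\<close> takes one value split into at most one block of each kind. Cutting a
  final block off a word in all possible ways, as \<open>peel\<close> does, is what relates consecutive stages.
\<close>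

definition block :: "nat \<Rightarrow> nat \<Rightarrow> nat list \<Rightarrow> bool" where
  "block j N ys \<longleftrightarrow> sorted_wrt (<) ys \<and> (\<forall>i<length ys. kind (N + i) (ys ! i) = j)"

definition peel :: "nat \<Rightarrow> 'a::comm_semiring_1 \<Rightarrow> (nat list \<Rightarrow> 'a) \<Rightarrow> nat list \<Rightarrow> 'a" where
  "peel j w g xs = (\<Sum>a\<le>length xs.
     if block j (length xs - a) (drop (length xs - a) xs) then w ^ a * g (take (length xs - a) xs) else 0)"

lemma block_Nil [simp]: "block j N []"
  by (simp add: block_def)

lemma sorted_wrt_less_snoc:
  "sorted_wrt (<) (ys @ [v :: nat]) \<longleftrightarrow> sorted_wrt (<) ys \<and> (ys = [] \<or> last ys < v)"
proof (cases ys rule: rev_cases)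
  case (snoc zs z)
  then show ?thesis
    by (auto simp: sorted_wrt_append)
qed simp

lemma block_snoc:
  "block j N (ys @ [v]) \<longleftrightarrow> block j N ys \<and> kind (N + length ys) v = j \<and> (ys = [] \<or> last ys < v)"
  by (auto simp: block_def sorted_wrt_less_snoc nth_append less_Suc_eq)

text \<open>
  Of the cuts of \<open>xs @ [v]\<close>, one is empty; each other one cuts off \<open>v\<close> together with a block of
  \<open>xs\<close> that \<open>v\<close> continues. If \<open>v\<close> does not exceed a last entry of the same kind, only the empty
  block of \<open>xs\<close> qualifies; if the last entry has another kind, only the empty block exists.
\<close>

lemma peel_snoc:
  "peel j w g (xs @ [v]) = g (xs @ [v]) +
     (if kind (length xs) v = j
      then w * (if xs \<noteq> [] \<and> last_kind xs = j \<and> v \<le> last xs then g xs else peel j w g xs)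
      else 0)"
proof -
  let ?n = "length xs"
  let ?f = "\<lambda>a. if block j (?n - a) (drop (?n - a) xs) then w ^ a * g (take (?n - a) xs) else 0"
  let ?h = "\<lambda>a. if block j (?n - a) (drop (?n - a) xs @ [v])
                then w ^ Suc a * g (take (?n - a) xs) else 0"
  have "peel j w g (xs @ [v]) = g (xs @ [v]) + (\<Sum>a\<le>?n. ?h a)"
    unfolding peel_def length_append_singleton
    by (simp add: sum.atMost_Suc_shift del: sum.atMost_Suc cong: if_cong)
  also have "(\<Sum>a\<le>?n. ?h a) =
     (if kind ?n v = j
      then w * (if xs \<noteq> [] \<and> last_kind xs = j \<and> v \<le> last xs then g xs else peel j w g xs)
      else 0)"
  proof (cases "kind ?n v = j")
    case False
    then show ?thesis
      by (simp add: block_snoc)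
  next
    case kv: True
    show ?thesis
    proof (cases "xs \<noteq> [] \<and> last_kind xs = j \<and> v \<le> last xs")
      case True
      have "?h a = (if a = 0 then w * g xs else 0)" if "a \<le> ?n" for a
        using that True kv by (auto simp: block_snoc)
      then have "(\<Sum>a\<le>?n. ?h a) = (\<Sum>a\<le>?n. if a = 0 then w * g xs else 0)"
        by (intro sum.cong) auto
      then show ?thesis
        using True kv by simp
    next
      case False
      have "?h a = w * ?f a" if "a \<le> ?n" for a
      proof (cases "a = 0")
        case False
        then have ne: "xs \<noteq> []" "drop (?n - a) xs \<noteq> []"
          using that by auto
        have "last xs < v" if "block j (?n - a) (drop (?n - a) xs)"
        proof -
          have "kind (?n - a + (a - 1)) (drop (?n - a) xs ! (a - 1)) = j"
            using that \<open>a \<le> ?n\<close> \<open>a \<noteq> 0\<close> unfolding block_def by (auto dest!: spec[of _ "a - 1"])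
          then have "last_kind xs = j"
            using \<open>a \<le> ?n\<close> \<open>a \<noteq> 0\<close> ne by (simp add: last_kind_def last_conv_nth)
          then show ?thesis
            using \<open>\<not> (xs \<noteq> [] \<and> _)\<close> ne by auto
        qed
        then show ?thesis
          using ne kv that by (auto simp: block_snoc mult_ac)
      qed (use kv in \<open>auto simp: block_def\<close>)
      then have "(\<Sum>a\<le>?n. ?h a) = w * (\<Sum>a\<le>?n. ?f a)"
        by (simp add: sum_distrib_left)
      then show ?thesis
        using kv unfolding if_not_P[OF False] by (simp add: peel_def)
    qed
  qed
  finally show ?thesis .
qed

lemma word_weight_snoc:
  fixes q :: "'a::field"
  assumes "\<And>i. i > 0 \<Longrightarrow> q ^ i \<noteq> 1"
  shows "(1 - q ^ Suc (length xs)) * word_weight q c (xs @ [v]) =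
     c (kind (length xs) v) *
     (if xs \<noteq> [] \<and> (kind (length xs) v < last_kind xs \<or> kind (length xs) v = last_kind xs \<and> v < last xs)
      then q ^ length xs else 1) * word_weight q c xs"
proof -
  have "1 - q ^ Suc (length xs) \<noteq> 0" "qpoch q (length xs) \<noteq> 0"
    using assms[of "Suc (length xs)"] qpoch_nonzero[OF assms] by auto
  then show ?thesis
    by (simp add: word_weight_def dexsum_snoc kind_weight_snoc qpoch_Suc power_add field_simps
        del: power_Suc)
qed

text \<open>
  Allowing zeros of \<open>f\<close> on places of kind \<open>j\<close> as well means choosing a final block of kind \<open>j\<close>
  where \<open>f = 0\<close> and restricting the zeros on the remaining word to kinds less than \<open>j\<close>.
\<close>

lemma peel_stage:
  fixes q :: "'a::field"
  assumes q: "\<And>i. i > 0 \<Longrightarrow> q ^ i \<noteq> 1" and "distinct xs"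
  shows "peel j (c j) (stage q c j) xs = stage q c (Suc j) xs"
  using \<open>distinct xs\<close>
proof (induction xs rule: rev_induct)
  case Nil
  then show ?case
    by (simp add: peel_def stage_def)
next
  case (snoc v xs)
  let ?n = "length xs"
  have lk: "last_kind (xs @ [v]) = kind ?n v"
    by (simp add: last_kind_def)
  show ?case
  proof (cases "kind ?n v = j")
    case False
    then show ?thesis
      by (auto simp: peel_snoc stage_def lk)
  next
    case True
    have *: "word_weight q c (xs @ [v]) = q ^ Suc ?n * word_weight q c (xs @ [v]) +
       c j * (if xs \<noteq> [] \<and> (j < last_kind xs \<or> j = last_kind xs \<and> v < last xs)
              then q ^ ?n else 1) * word_weight q c xs"
      using word_weight_snoc[OF q, of xs c v] True by (simp add: algebra_simps split: if_splits)
    have ne: "v \<noteq> last xs" if "xs \<noteq> []"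
      using snoc.prems that by auto
    have IH: "peel j (c j) (stage q c j) xs = stage q c (Suc j) xs"
      using snoc by simp
    show ?thesis
      unfolding peel_snoc IH using ne True
      by (subst stage_def, subst (3) stage_def, subst (2) *) (auto simp: lk stage_def)
  qed
qed

section \<open>Counting the blocks that extend a partial permutation\<close>

text \<open>
  Cutting a permutation after its first \<open>N\<close> places leaves a word that uses values below \<open>N\<close> and a
  set \<open>S\<close> of values that are at least \<open>N\<close>; the latter belong to excedances that cross the cut.
  Permutations are the case \<open>S = {}\<close>. Keeping the set \<open>S\<close> rather than standardising its elements
  makes truncation of words the only map involved.
\<close>

definition partials :: "nat \<Rightarrow> nat set \<Rightarrow> nat list set" where
  "partials N S = {xs. length xs = N \<and> distinct xs \<and> set xs - {..<N} = S}"

lemma finite_partials: "finite (partials N S)"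
proof (cases "finite S")
  case True
  have "partials N S \<subseteq> {xs. set xs \<subseteq> {..<N} \<union> S \<and> length xs = N}"
    unfolding partials_def by blast
  then show ?thesis
    by (rule finite_subset) (simp add: True finite_lists_length_eq)
next
  case False
  then have "partials N S = {}"
    by (auto simp: partials_def)
  then show ?thesis
    by simp
qed

definition extensions :: "nat \<Rightarrow> nat \<Rightarrow> nat \<Rightarrow> nat set \<Rightarrow> nat list \<Rightarrow> nat list set" where
  "extensions j N a S' xs = {ys. length ys = a \<and> block j N ys \<and> xs @ ys \<in> partials (N + a) S'}"

lemma finite_extensions: "finite (extensions j N a S' xs)"
proof -
  have "inj_on (\<lambda>ys. xs @ ys) (extensions j N a S' xs)"
    by (auto intro: inj_onI)
  moreover have "(\<lambda>ys. xs @ ys) ` extensions j N a S' xs \<subseteq> partials (N + a) S'"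
    by (auto simp: extensions_def)
  ultimately show ?thesis
    by (rule inj_on_finite) (rule finite_partials)
qed

text \<open>
  A word ending in a block of length \<open>a\<close> is the same as its first part together with an admissible
  extension; the sum is sorted by the set \<open>S\<close> of values with which the first part crosses the cut.
\<close>

lemma sum_block_split:
  fixes g :: "nat list \<Rightarrow> 'a::comm_semiring_1"
  assumes "finite S'" "S' \<subseteq> {N + a..}"
  shows "(\<Sum>xs\<in>{xs \<in> partials (N + a) S'. block j N (drop N xs)}. g (take N xs)) =
    (\<Sum>S\<in>Pow ({N..<N + a} \<union> S'). \<Sum>xs\<in>partials N S. of_nat (card (extensions j N a S' xs)) * g xs)"
proof -
  let ?U = "\<Union>S\<in>Pow ({N..<N + a} \<union> S'). partials N S"
  have fin: "finite (Pow ({N..<N + a} \<union> S'))"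
    using assms(1) by simp
  then have finU: "finite ?U"
    by (rule finite_UN_I) (rule finite_partials)
  have "(\<Sum>S\<in>Pow ({N..<N + a} \<union> S'). \<Sum>xs\<in>partials N S. of_nat (card (extensions j N a S' xs)) * g xs)
     = (\<Sum>xs\<in>?U. of_nat (card (extensions j N a S' xs)) * g xs)"
    by (rule sum.UNION_disjoint[symmetric]) (use fin finite_partials in \<open>auto simp: partials_def\<close>)
  also have "\<dots> = (\<Sum>xs\<in>?U. \<Sum>ys\<in>extensions j N a S' xs. g xs)"
    by simp
  also have "\<dots> = (\<Sum>(xs, ys)\<in>Sigma ?U (extensions j N a S'). g xs)"
    using finU finite_extensions by (intro sum.Sigma) blast+
  also have "\<dots> = (\<Sum>xs\<in>{xs \<in> partials (N + a) S'. block j N (drop N xs)}. g (take N xs))"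
  proof (rule sum.reindex_bij_witness[where i = "\<lambda>xs. (take N xs, drop N xs)" and j = "\<lambda>(xs, ys). xs @ ys"])
    fix xs assume "xs \<in> {xs \<in> partials (N + a) S'. block j N (drop N xs)}"
    then have xs: "xs \<in> partials (N + a) S'" "block j N (drop N xs)"
      by simp_all
    have len: "length xs = N + a" and d: "distinct xs" and S': "set xs - {..<N + a} = S'"
      using xs(1) by (simp_all add: partials_def)
    show "(take N xs, drop N xs) \<in> Sigma ?U (extensions j N a S')"
    proof (intro SigmaI UN_I PowI)
      show "set (take N xs) - {..<N} \<subseteq> {N..<N + a} \<union> S'"
        using set_take_subset[of N xs] S' by auto
      show "take N xs \<in> partials N (set (take N xs) - {..<N})"
        using len d by (simp add: partials_def)
      show "drop N xs \<in> extensions j N a S' (take N xs)"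
        using len xs by (simp add: extensions_def)
    qed
  qed (auto simp: extensions_def partials_def)
  finally show ?thesis ..
qed

lemma sum_peel:
  fixes g :: "nat list \<Rightarrow> 'a::comm_semiring_1"
  assumes "finite S'" "S' \<subseteq> {N'..}"
  shows "(\<Sum>xs\<in>partials N' S'. peel j w g xs) =
    (\<Sum>a\<le>N'. w ^ a * (\<Sum>S\<in>Pow ({N' - a..<N'} \<union> S').
        \<Sum>xs\<in>partials (N' - a) S. of_nat (card (extensions j (N' - a) a S' xs)) * g xs))"
proof -
  have "(\<Sum>xs\<in>partials N' S'. peel j w g xs) = (\<Sum>xs\<in>partials N' S'. \<Sum>a\<le>N'.
      if block j (N' - a) (drop (N' - a) xs) then w ^ a * g (take (N' - a) xs) else 0)"
    by (intro sum.cong) (auto simp: peel_def partials_def)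
  also have "\<dots> = (\<Sum>a\<le>N'. \<Sum>xs\<in>partials N' S'.
      if block j (N' - a) (drop (N' - a) xs) then w ^ a * g (take (N' - a) xs) else 0)"
    by (rule sum.swap)
  also have "\<dots> = (\<Sum>a\<le>N'. w ^ a * (\<Sum>xs\<in>{xs \<in> partials N' S'. block j (N' - a) (drop (N' - a) xs)}.
      g (take (N' - a) xs)))"
    by (simp add: sum.inter_filter finite_partials sum_distrib_left if_distrib cong: if_cong)
  also have "\<dots> = (\<Sum>a\<le>N'. w ^ a * (\<Sum>S\<in>Pow ({N' - a..<N'} \<union> S').
        \<Sum>xs\<in>partials (N' - a) S. of_nat (card (extensions j (N' - a) a S' xs)) * g xs))"
  proof (intro sum.cong refl arg_cong[where f = "(*) _"])
    fix a assume "a \<in> {..N'}"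
    then show "(\<Sum>xs\<in>{xs \<in> partials N' S'. block j (N' - a) (drop (N' - a) xs)}. g (take (N' - a) xs)) =
       (\<Sum>S\<in>Pow ({N' - a..<N'} \<union> S').
          \<Sum>xs\<in>partials (N' - a) S. of_nat (card (extensions j (N' - a) a S' xs)) * g xs)"
      using sum_block_split[OF assms(1), of "N' - a" a g j] assms(2) by simp
  qed
  finally show ?thesis .
qed

text \<open>
  The number of blocks of kind \<open>j\<close> and length \<open>a\<close> that turn a word in \<open>partials N S\<close> into one in
  \<open>partials (N + a) S'\<close>. What makes the whole method work is that it depends on the word only
  through \<open>S\<close>. For excedances the values of the block avoid \<open>N\<close>: an increasing block consists of
  excedances exactly if its first entry exceeds its place. Dually, an increasing block consists of
  antiexcedances exactly if its last entry is below its place, so its values are any \<open>a\<close> of the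
  unused ones below \<open>N + a - 1\<close>; there are \<open>a - 1 + card S'\<close> of these, and one more if the value
  \<open>N + a - 1\<close> has been used up by \<open>S\<close>. A block of fixed points can be added in one way, when no
  value of \<open>S\<close> is in its range.
\<close>

definition ext_count :: "nat \<Rightarrow> nat \<Rightarrow> nat \<Rightarrow> nat set \<Rightarrow> nat set \<Rightarrow> nat" where
  "ext_count j N a S S' =
    (if j = 0 then card {T. T \<subseteq> {Suc N..<N + a} \<union> S' \<and> card T = a \<and> T \<inter> S = {} \<and> S' \<subseteq> S \<union> T}
     else if j = 1 then
       (if \<not> S' \<subseteq> S then 0
        else if a = 0 then 1
        else (a - 1 + card S' + (if N + a - 1 \<in> S then 1 else 0)) choose a)
     else if S = S' then 1 else 0)"

text \<open>
  An increasing block is determined by its set of values.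
\<close>

lemma card_strictly_sorted_lists:
  assumes "\<And>T. P T \<Longrightarrow> finite T"
  shows "card {ys. length ys = a \<and> sorted_wrt (<) ys \<and> P (set ys)} = card {T::nat set. card T = a \<and> P T}"
proof -
  have "bij_betw set {ys. length ys = a \<and> sorted_wrt (<) ys \<and> P (set ys)} {T::nat set. card T = a \<and> P T}"
    by (rule bij_betw_byWitness[where f' = sorted_list_of_set])
      (use assms in \<open>auto simp: strict_sorted_iff distinct_card
         sorted_list_of_set.idem_if_sorted_distinct\<close>)
  then show ?thesis
    by (rule bij_betw_same_card)
qed

lemma sorted_wrt_less_nth_gap:
  assumes "sorted_wrt (<) (ys :: nat list)" "i + d < length ys"
  shows "ys ! i + d \<le> ys ! (i + d)"
  using assms(2)
proof (induction d)
  case (Suc d)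
  have "ys ! (i + d) < ys ! (i + Suc d)"
    using assms(1) Suc.prems by (simp add: sorted_wrt_iff_nth_less)
  then show ?case
    using Suc by simp
qed simp

text \<open>
  An increasing sequence of naturals grows at least as fast as the places, so it stays above the
  diagonal if it starts above it.
\<close>

lemma block_0_iff: "block 0 N ys \<longleftrightarrow> sorted_wrt (<) ys \<and> set ys \<subseteq> {Suc N..}"
proof -
  have "kind (N + i) (ys ! i) = 0" if "sorted_wrt (<) ys" "set ys \<subseteq> {Suc N..}" "i < length ys" for i
  proof -
    have "0 < length ys"
      using that(3) by linarith
    then have "Suc N \<le> ys ! 0"
      using that(2) nth_mem by fastforce
    then show ?thesis
      using sorted_wrt_less_nth_gap[of ys 0 i] that by (simp add: kind_def)
  qed
  moreover have "Suc N \<le> v" if "\<forall>i<length ys. kind (N + i) (ys ! i) = 0" "v \<in> set ys" for v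
    using that by (fastforce simp: in_set_conv_nth kind_def split: if_splits)
  ultimately show ?thesis
    by (auto simp: block_def)
qed

text \<open>
  Dually, an increasing sequence that ends below the diagonal has been below it all the time.
\<close>

lemma block_1_iff:
  "block 1 N ys \<longleftrightarrow> sorted_wrt (<) ys \<and> set ys \<subseteq> {..<N + length ys - 1}"
proof -
  have "kind (N + i) (ys ! i) = 1"
    if "sorted_wrt (<) ys" "set ys \<subseteq> {..<N + length ys - 1}" "i < length ys" for i
  proof -
    have "ys ! (length ys - 1) < N + length ys - 1"
      using that by (metis lessThan_iff nth_mem subsetD diff_less zero_less_one less_trans not_gr_zero
          not_less_zero)
    then show ?thesis
      using sorted_wrt_less_nth_gap[of ys i "length ys - 1 - i"] that
      by (simp add: kind_def) linarith
  qed
  moreover have "v < N + length ys - 1" 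
    if kinds: "\<forall>i<length ys. kind (N + i) (ys ! i) = 1" and v: "v \<in> set ys" for v
  proof -
    obtain i where i: "i < length ys" "ys ! i = v"
      using v by (auto simp: in_set_conv_nth)
    have "ys ! i < N + i"
      using kinds i by (auto simp: kind_def split: if_splits)
    then show ?thesis
      using i by simp
  qed
  ultimately show ?thesis
    by (auto simp: block_def)
qed

lemma block_2_iff: "block 2 N ys \<longleftrightarrow> ys = [N..<N + length ys]"
proof
  assume "block 2 N ys"
  then have "kind (N + i) (ys ! i) = 2" if "i < length ys" for i
    using that by (simp add: block_def)
  then have "ys ! i = N + i" if "i < length ys" for i
    using that by (metis kind_def linorder_neqE_nat one_eq_numeral_iff semiring_norm(85) zero_neq_numeral)
  then show "ys = [N..<N + length ys]"
    by (intro nth_equalityI) auto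
next
  assume "ys = [N..<N + length ys]"
  then show "block 2 N ys"
    by (metis block_def kind_def length_upt less_irrefl nth_upt sorted_wrt_upt diff_add_inverse
        nat_add_left_cancel_less)
qed

text \<open>
  In each case the extending blocks correspond to their sets of values, and the requirement that the
  extended word lie in \<open>partials (N + a) S'\<close> becomes a condition on that set.
\<close>

lemma card_extensions:
  assumes xs: "xs \<in> partials N S" and S: "S \<subseteq> {N..<N + a} \<union> S'"
    and S': "finite S'" "S' \<subseteq> {N + a..}" and "j < 3"
  shows "card (extensions j N a S' xs) = ext_count j N a S S'"
proof -
  have xs': "length xs = N" "distinct xs" "set xs - {..<N} = S"
    using xs by (auto simp: partials_def)
  have SS: "S \<subseteq> {N..}" "S \<subseteq> set xs" "set xs \<subseteq> {..<N} \<union> S"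
    using xs' by auto
  have app: "xs @ ys \<in> partials (N + a) S' \<longleftrightarrow>
      distinct ys \<and> set ys \<inter> set xs = {} \<and> (S \<union> set ys) - {..<N + a} = S'" if "length ys = a" for ys
    using that xs' by (fastforce simp: partials_def)
  consider "j = 0" | "j = 1" | "j = 2"
    using \<open>j < 3\<close> by linarith
  then show ?thesis
  proof cases
    case 1
    have "extensions 0 N a S' xs = {ys. length ys = a \<and> sorted_wrt (<) ys \<and>
        (set ys \<subseteq> {Suc N..<N + a} \<union> S' \<and> set ys \<inter> S = {} \<and> S' \<subseteq> S \<union> set ys)}"
    proof -
      have "block 0 N ys \<and> xs @ ys \<in> partials (N + a) S' \<longleftrightarrow> sorted_wrt (<) ys \<and>
        (set ys \<subseteq> {Suc N..<N + a} \<union> S' \<and> set ys \<inter> S = {} \<and> S' \<subseteq> S \<union> set ys)" (is "?l \<longleftrightarrow> ?r")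
        if "length ys = a" for ys
      proof
        assume ?l
        then have *: "sorted_wrt (<) ys" "set ys \<subseteq> {Suc N..}" "set ys \<inter> set xs = {}"
          "(S \<union> set ys) - {..<N + a} = S'"
          using app[OF that] by (auto simp: block_0_iff)
        have "set ys \<subseteq> {Suc N..<N + a} \<union> S'"
          using *(2,4) by fastforce
        then show ?r
          using * SS by auto
      next
        assume r: ?r
        have "set ys \<subseteq> {Suc N..}"
        proof (cases "a = 0")
          case False
          then have "{N + a..} \<subseteq> {Suc N..}"
            by auto
          then show ?thesis
            using r S' by fastforce
        qed (use that in simp)
        moreover from this have "set ys \<inter> set xs = {}"
          using r SS by fastforce
        moreover have "(S \<union> set ys) - {..<N + a} = S'"
          using r S S' by fastforce
        ultimately show ?l
          using r app[OF that] by (auto simp: block_0_iff strict_sorted_iff)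
      qed
      then show ?thesis
        by (auto simp: extensions_def)
    qed
    then have "card (extensions 0 N a S' xs) = card {T. card T = a \<and>
        (T \<subseteq> {Suc N..<N + a} \<union> S' \<and> T \<inter> S = {} \<and> S' \<subseteq> S \<union> T)}"
      using card_strictly_sorted_lists[of "\<lambda>T. T \<subseteq> {Suc N..<N + a} \<union> S' \<and> T \<inter> S = {} \<and> S' \<subseteq> S \<union> T" a]
        S' by (auto intro: finite_subset)
    then show ?thesis
      using 1 by (simp add: ext_count_def conj_ac)
  next
    case 2
    let ?A = "{..<N + a - 1} - set xs"
    have ext: "extensions 1 N a S' xs =
        {ys. length ys = a \<and> sorted_wrt (<) ys \<and> (set ys \<subseteq> ?A \<and> S' \<subseteq> S)}"
    proof -
      have "block 1 N ys \<and> xs @ ys \<in> partials (N + a) S' \<longleftrightarrow> sorted_wrt (<) ys \<and>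
        (set ys \<subseteq> ?A \<and> S' \<subseteq> S)" (is "?l \<longleftrightarrow> ?r")
        if "length ys = a" for ys
      proof
        assume ?l
        then have *: "sorted_wrt (<) ys" "set ys \<subseteq> {..<N + a - 1}" "set ys \<inter> set xs = {}"
          "(S \<union> set ys) - {..<N + a} = S'"
          using app[OF that] that by (auto simp: block_1_iff[unfolded One_nat_def])
        then have "S' \<subseteq> S"
          by fastforce
        then show ?r
          using * by auto
      next
        assume r: ?r
        moreover from this have "(S \<union> set ys) - {..<N + a} = S'"
          using r S S' by fastforce
        ultimately show ?l
          using app[OF that] that by (auto simp: block_1_iff[unfolded One_nat_def] strict_sorted_iff)
      qed
      then show ?thesis
        by (auto simp: extensions_def)
    qed
    have "card (extensions 1 N a S' xs) = card {T. card T = a \<and> (T \<subseteq> ?A \<and> S' \<subseteq> S)}"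
      unfolding ext by (rule card_strictly_sorted_lists) (auto intro: finite_subset)
    also have "\<dots> = (if S' \<subseteq> S then card ?A choose a else 0)"
      using n_subsets[of ?A a] by (simp add: conj_ac)
    finally have card: "card (extensions 1 N a S' xs) = (if S' \<subseteq> S then card ?A choose a else 0)" .
    moreover have "card ?A = a - 1 + card S' + (if N + a - 1 \<in> S then 1 else 0)"
      if "S' \<subseteq> S" "a > 0"
    proof -
      let ?B = "{..<N + a - 1} \<inter> set xs" and ?C = "S \<inter> {N + a - 1}"
      \<comment> \<open>This splits the \<open>N\<close> values of \<open>xs\<close>, so that the unused values in \<open>?A\<close> can be counted.\<close>
      have "v \<in> (?B \<union> ?C) \<union> S'" if "v \<in> set xs" for v
      proof (cases "v < N + a - 1")
        case False
        then have "v \<in> S"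
          using that \<open>a > 0\<close> xs'(3) by auto
        then have "v < N + a \<or> v \<in> S'"
          using S by auto
        then have "v = N + a - 1 \<or> v \<in> S'"
          using False by linarith
        then show ?thesis
          using \<open>v \<in> S\<close> by auto
      qed (use that in simp)
      then have union: "set xs = (?B \<union> ?C) \<union> S'"
        using SS(2) that(1) by auto
      have "(?B \<union> ?C) \<inter> S' = {}" "?B \<inter> ?C = {}"
        using S' that by auto
      moreover have "finite ?B" "finite ?C"
        by simp_all
      ultimately have "card ((?B \<union> ?C) \<union> S') = card ?B + card ?C + card S'"
        using S'(1) by (simp add: card_Un_disjoint)
      then have "card (set xs) = card ?B + card ?C + card S'"
        by (simp only: union[symmetric])
      then have "N = card ?B + card ?C + card S'"
        using xs' distinct_card by metis
      moreover have "card ?A = N + a - 1 - card ?B"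
        by (simp add: card_Diff_subset_Int)
      moreover have "card ?C = (if N + a - 1 \<in> S then 1 else 0)"
        by auto
      ultimately show ?thesis
        using that by linarith
    qed
    ultimately show ?thesis
      using 2 by (simp add: ext_count_def)
  next
    case 3
    have "extensions 2 N a S' xs = (if S = S' then {[N..<N + a]} else {})"
    proof -
      have "block 2 N ys \<and> xs @ ys \<in> partials (N + a) S' \<longleftrightarrow> ys = [N..<N + a] \<and> S = S'"
        if "length ys = a" for ys
      proof -
        have "set [N..<N + a] \<inter> set xs = {} \<and> (S \<union> set [N..<N + a]) - {..<N + a} = S' \<longleftrightarrow> S = S'"
        proof
          assume *: "set [N..<N + a] \<inter> set xs = {} \<and> (S \<union> set [N..<N + a]) - {..<N + a} = S'"
          then have "S \<inter> {N..<N + a} = {}"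
            using SS(2) by auto
          moreover have "S' \<subseteq> S"
            using * by auto
          ultimately show "S = S'"
            using S by blast
        next
          assume "S = S'"
          moreover have "{N..<N + a} \<inter> set xs \<subseteq> S"
            using SS(3) by auto
          ultimately show "set [N..<N + a] \<inter> set xs = {} \<and> (S \<union> set [N..<N + a]) - {..<N + a} = S'"
            using S'(2) by auto
        qed
        moreover have "block 2 N ys \<longleftrightarrow> ys = [N..<N + a]"
          unfolding block_2_iff that ..
        ultimately show ?thesis
          unfolding app[OF that] by (metis distinct_upt)
      qed
      note * = this
      show ?thesis
      proof (rule set_eqI)
        fix ys
        show "ys \<in> extensions 2 N a S' xs \<longleftrightarrow> ys \<in> (if S = S' then {[N..<N + a]} else {})"
          using *[of ys] by (cases "length ys = a") (auto simp: extensions_def)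
      qed
    qed
    then show ?thesis
      using 3 by (simp add: ext_count_def)
  qed
qed

unbundle fps_syntax

section \<open>Adding a block as a linear operator\<close>

definition block_transfer ::
    "nat \<Rightarrow> 'a::comm_semiring_1 \<Rightarrow> (nat \<Rightarrow> nat set \<Rightarrow> 'a) \<Rightarrow> nat \<Rightarrow> nat set \<Rightarrow> 'a" where
  "block_transfer j w V N' S' = (\<Sum>a\<le>N'. w ^ a * (\<Sum>S\<in>Pow ({N' - a..<N'} \<union> S').
      of_nat (ext_count j (N' - a) a S S') * V (N' - a) S))"

lemma sum_peel_eq_block_transfer:
  fixes g :: "nat list \<Rightarrow> 'a::comm_semiring_1"
  assumes "finite S'" "S' \<subseteq> {N'..}" "j < 3"
  shows "(\<Sum>xs\<in>partials N' S'. peel j w g xs) =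
    block_transfer j w (\<lambda>N S. \<Sum>xs\<in>partials N S. g xs) N' S'"
  unfolding sum_peel[OF assms(1,2)] block_transfer_def sum_distrib_left
proof (intro sum.cong refl)
  fix a S xs
  assume "a \<in> {..N'}" "S \<in> Pow ({N' - a..<N'} \<union> S')" "xs \<in> partials (N' - a) S"
  then show "w ^ a * (of_nat (card (extensions j (N' - a) a S' xs)) * g xs) =
        w ^ a * (of_nat (ext_count j (N' - a) a S S') * g xs)"
    using card_extensions[of xs "N' - a" S a S' j] assms by simp
qed

lemma ext_count_0_length:
  assumes "S \<subseteq> S'" "finite S'" "j < 3"
  shows "ext_count j N 0 S S' = (if S = S' then 1 else 0)"
proof -
  have "{T. T \<subseteq> S' \<and> card T = 0 \<and> T \<inter> S = {} \<and> S' \<subseteq> S \<union> T} = (if S = S' then {{}} else {})"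
    using assms by (auto dest: finite_subset)
  then show ?thesis
    using assms by (auto simp: ext_count_def)
qed

text \<open>
  The summand of \<open>block_transfer\<close> for the empty block is the value at \<open>(N', S')\<close> itself, all others
  involve smaller lengths. Hence the operator preserves a difference that first shows up at \<open>N'\<close>.
\<close>

lemma block_transfer_diff:
  fixes V W :: "nat \<Rightarrow> nat set \<Rightarrow> 'a::comm_ring_1"
  assumes eq: "\<And>N S. \<lbrakk>N < N'; finite S; S \<subseteq> {N..}\<rbrakk> \<Longrightarrow> V N S = W N S"
    and S': "finite S'" "S' \<subseteq> {N'..}" and "j < 3"
  shows "block_transfer j w V N' S' - block_transfer j w W N' S' = V N' S' - W N' S'"
proof -
  let ?f = "\<lambda>a. w ^ a * (\<Sum>S\<in>Pow ({N' - a..<N'} \<union> S').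
      of_nat (ext_count j (N' - a) a S S') * (V (N' - a) S - W (N' - a) S))"
  have "block_transfer j w V N' S' - block_transfer j w W N' S' = (\<Sum>a\<le>N'. ?f a)"
    by (simp add: block_transfer_def sum_subtractf right_diff_distrib)
  also have "\<dots> = (\<Sum>a\<in>{0}. ?f a)"
  proof (rule sum.mono_neutral_right)
    show "\<forall>a\<in>{..N'} - {0}. ?f a = 0"
    proof
      fix a assume a: "a \<in> {..N'} - {0}"
      have "V (N' - a) S = W (N' - a) S" if "S \<in> Pow ({N' - a..<N'} \<union> S')" for S
      proof (rule eq)
        show "finite S"
          using that S'(1) by (auto intro: finite_subset)
        show "S \<subseteq> {N' - a..}"
          using that S'(2) by fastforce
      qed (use a in auto)
      then show "?f a = 0"
        by simp
    qed
  qed auto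
  also have "\<dots> = (\<Sum>S\<in>Pow S'. if S = S' then V N' S - W N' S else 0)"
    using ext_count_0_length[OF _ S'(1) \<open>j < 3\<close>] by (auto intro!: sum.cong)
  also have "\<dots> = V N' S' - W N' S'"
    using S'(1) by simp
  finally show ?thesis .
qed

lemma sum_Pow_weighted:
  fixes x y :: "'a::comm_semiring_1"
  assumes "finite A"
  shows "(\<Sum>S\<in>Pow A. x ^ card S * y ^ (card A - card S)) = (x + y) ^ card A"
proof -
  have "(x + y) ^ card A = (\<Sum>S\<in>Pow A. x ^ card S * y ^ card (A - S))"
    using prod_add[OF assms, of "\<lambda>_. x" "\<lambda>_. y"] by simp
  also have "\<dots> = (\<Sum>S\<in>Pow A. x ^ card S * y ^ (card A - card S))"
    using assms by (intro sum.cong) (auto simp: card_Diff_subset finite_subset)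
  finally show ?thesis ..
qed

lemma sum_Pow_power:
  fixes x :: "'a::comm_semiring_1"
  assumes "finite A"
  shows "(\<Sum>S\<in>Pow A. x ^ card S) = (1 + x) ^ card A"
  using sum_Pow_weighted[OF assms, of x 1] by (simp add: add.commute)

lemma sum_between_power:
  fixes x :: "'a::comm_semiring_1"
  assumes "finite A" "finite B" "A \<inter> B = {}"
  shows "(\<Sum>S | B \<subseteq> S \<and> S \<subseteq> A \<union> B. x ^ card S) = x ^ card B * (1 + x) ^ card A"
proof -
  have "(\<Sum>S | B \<subseteq> S \<and> S \<subseteq> A \<union> B. x ^ card S) = (\<Sum>S\<in>Pow A. x ^ card B * x ^ card S)"
    by (rule sum.reindex_bij_witness[where i = "\<lambda>S. S \<union> B" and j = "\<lambda>S. S - B"])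
      (use assms in \<open>auto simp: card_Diff_subset card_mono power_add[symmetric] finite_subset\<close>)
  then show ?thesis
    using sum_Pow_power[OF assms(1), of x] by (simp add: sum_distrib_left[symmetric])
qed

lemma sum_shifted_nth:
  fixes F :: "'a::comm_semiring_1 fps"
  shows "(\<Sum>a\<le>n. c a * F $ (n - a)) = (Abs_fps c * F) $ n"
  by (simp add: fps_mult_nth atMost_atLeast0)

section \<open>The operators on geometric families\<close>

text \<open>
  The families that are preserved by adding blocks: as a power series in the length, the value at
  \<open>S\<close> is \<open>G\<close> times one factor \<open>p\<close> for each value crossing the cut. Each of the three operators
  acts on \<open>p\<close> by a fractional linear map and multiplies \<open>G\<close> by a series.
\<close>

definition geom_value :: "'a::comm_semiring_1 fps \<Rightarrow> 'a fps \<Rightarrow> nat \<Rightarrow> nat set \<Rightarrow> 'a" where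
  "geom_value G p N S = (G * p ^ card S) $ N"

text \<open>
  Exchange the choice of \<open>S\<close> with that of the block values \<open>T\<close>. For fixed \<open>T\<close> the set \<open>S\<close> consists
  of \<open>S' - T\<close> and an arbitrary subset of the values in \<open>{N..<N + a}\<close> missed by \<open>T\<close>; there are as
  many of those as \<open>T\<close> has elements in \<open>S'\<close>. What remains of \<open>T\<close> is a choice among the \<open>a - 1\<close>
  values in \<open>{Suc N..<N + a}\<close>.
\<close>

lemma sum_ext_count_0:
  fixes p :: "'a::comm_semiring_1"
  assumes "finite S'" "S' \<subseteq> {N + a..}"
  shows "(\<Sum>S\<in>Pow ({N..<N + a} \<union> S'). of_nat (ext_count 0 N a S S') * p ^ card S) =
    (\<Sum>T\<in>Pow S'. of_nat (if card T \<le> a then (a - 1) choose (a - card T) else 0)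
        * (((1 + p) ^ card T) * p ^ (card S' - card T)))"
proof -
  let ?I = "{N..<N + a}" and ?J = "{Suc N..<N + a}"
  let ?C = "\<lambda>S T. T \<subseteq> ?J \<union> S' \<and> card T = a \<and> T \<inter> S = {} \<and> S' \<subseteq> S \<union> T"
  let ?TT = "{T. T \<subseteq> ?J \<union> S' \<and> card T = a}"
  have fin: "finite ?TT"
    using assms(1) by (auto intro: finite_subset[of _ "Pow (?J \<union> S')"])
  have disj: "?I \<inter> S' = {}"
    using assms(2) by auto
  have JI: "?J \<subseteq> ?I"
    by auto
  have "(\<Sum>S\<in>Pow (?I \<union> S'). of_nat (ext_count 0 N a S S') * p ^ card S)
      = (\<Sum>S\<in>Pow (?I \<union> S'). \<Sum>T | T \<in> ?TT \<and> (T \<inter> S = {} \<and> S' \<subseteq> S \<union> T). p ^ card S)"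
    by (simp add: ext_count_def conj_ac)
  also have "\<dots> = (\<Sum>T\<in>?TT. \<Sum>S | S \<in> Pow (?I \<union> S') \<and> (T \<inter> S = {} \<and> S' \<subseteq> S \<union> T). p ^ card S)"
    using fin assms(1) by (intro sum.swap_restrict) auto
  also have "\<dots> = (\<Sum>T\<in>?TT. (1 + p) ^ card (S' \<inter> T) * p ^ (card S' - card (S' \<inter> T)))"
  proof (rule sum.cong[OF refl])
    fix T assume T: "T \<in> ?TT"
    then have finT: "finite T"
      using assms(1) by (auto intro: finite_subset)
    have "{S. S \<in> Pow (?I \<union> S') \<and> (T \<inter> S = {} \<and> S' \<subseteq> S \<union> T)}
        = {S. S' - T \<subseteq> S \<and> S \<subseteq> (?I - T) \<union> (S' - T)}"
      by blast
    moreover have "(\<Sum>S | S' - T \<subseteq> S \<and> S \<subseteq> (?I - T) \<union> (S' - T). p ^ card S)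
        = p ^ card (S' - T) * (1 + p) ^ card (?I - T)"
      using assms(1) disj by (intro sum_between_power) auto
    moreover have "card (S' - T) = card S' - card (S' \<inter> T)"
      by (rule card_Diff_subset_Int) (use assms(1) in simp)
    moreover have "card (?I - T) = card (S' \<inter> T)"
    proof -
      have "T = (?I \<inter> T) \<union> (S' \<inter> T)"
        using T by auto
      then have "card T = card (?I \<inter> T) + card (S' \<inter> T)"
        using card_Un_disjoint[of "?I \<inter> T" "S' \<inter> T"] disj finT by auto
      moreover have "card (?I - T) = a - card (?I \<inter> T)"
        by (subst card_Diff_subset_Int) auto
      moreover have "card T = a"
        using T by simp
      ultimately show ?thesis
        by linarith
    qed
    ultimately show "(\<Sum>S | S \<in> Pow (?I \<union> S') \<and> (T \<inter> S = {} \<and> S' \<subseteq> S \<union> T). p ^ card S) =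
        (1 + p) ^ card (S' \<inter> T) * p ^ (card S' - card (S' \<inter> T))"
      by (simp add: mult.commute)
  qed
  also have "\<dots> = (\<Sum>T2\<in>Pow S'. \<Sum>T | T \<in> ?TT \<and> S' \<inter> T = T2.
      (1 + p) ^ card (S' \<inter> T) * p ^ (card S' - card (S' \<inter> T)))"
    by (rule sum.group[symmetric]) (use fin assms(1) in auto)
  also have "\<dots> = (\<Sum>T\<in>Pow S'. of_nat (if card T \<le> a then (a - 1) choose (a - card T) else 0)
        * (((1 + p) ^ card T) * p ^ (card S' - card T)))"
  proof (rule sum.cong[OF refl])
    fix T2 assume T2: "T2 \<in> Pow S'"
    then have finT2: "finite T2"
      using assms(1) by (auto intro: finite_subset)
    have "bij_betw (\<lambda>T. T - T2) {T. T \<in> ?TT \<and> S' \<inter> T = T2} {T. T \<subseteq> ?J \<and> card T + card T2 = a}"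
    proof (rule bij_betw_byWitness[where f' = "\<lambda>T. T \<union> T2"])
      show "\<forall>T\<in>{T. T \<subseteq> ?J \<and> card T + card T2 = a}. T \<union> T2 - T2 = T"
        using disj JI T2 by blast
      show "(\<lambda>T. T - T2) ` {T. T \<in> ?TT \<and> S' \<inter> T = T2} \<subseteq> {T. T \<subseteq> ?J \<and> card T + card T2 = a}"
      proof (rule image_subsetI)
        fix T assume T: "T \<in> {T. T \<in> ?TT \<and> S' \<inter> T = T2}"
        then have "finite T" "T2 \<subseteq> T" "card T = a"
          using assms(1) by (auto intro: finite_subset)
        then have "card (T - T2) + card T2 = a"
          using card_Diff_subset[OF finT2] card_mono[of T T2] by simp
        moreover have "T - T2 \<subseteq> ?J"
          using T by blast
        ultimately show "T - T2 \<in> {T. T \<subseteq> ?J \<and> card T + card T2 = a}"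
          by simp
      qed
      show "(\<lambda>T. T \<union> T2) ` {T. T \<subseteq> ?J \<and> card T + card T2 = a} \<subseteq> {T. T \<in> ?TT \<and> S' \<inter> T = T2}"
      proof (rule image_subsetI)
        fix T assume "T \<in> {T. T \<subseteq> ?J \<and> card T + card T2 = a}"
        then have T: "T \<subseteq> ?J" "card T + card T2 = a"
          by simp_all
        have "T \<inter> S' = {}" "T \<inter> T2 = {}"
          using T(1) T2 disj JI by blast+
        moreover have "finite T"
          using T(1) by (rule finite_subset) simp
        ultimately have "card (T \<union> T2) = a" "S' \<inter> (T \<union> T2) = T2" "T \<union> T2 \<subseteq> ?J \<union> S'"
          using T T2 finT2 card_Un_disjoint[of T T2] by auto
        then show "T \<union> T2 \<in> {T. T \<in> ?TT \<and> S' \<inter> T = T2}"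
          by simp
      qed
    qed auto
    then have "card {T. T \<in> ?TT \<and> S' \<inter> T = T2} = card {T. T \<subseteq> ?J \<and> card T + card T2 = a}"
      by (rule bij_betw_same_card)
    also have "\<dots> = (if card T2 \<le> a then (a - 1) choose (a - card T2) else 0)"
    proof (cases "card T2 \<le> a")
      case True
      then have "{T. T \<subseteq> ?J \<and> card T + card T2 = a} = {T. T \<subseteq> ?J \<and> card T = a - card T2}"
        by auto
      then show ?thesis
        using True n_subsets[of ?J "a - card T2"] by simp
    qed auto
    finally show "(\<Sum>T | T \<in> ?TT \<and> S' \<inter> T = T2.
         (1 + p) ^ card (S' \<inter> T) * p ^ (card S' - card (S' \<inter> T))) =
       of_nat (if card T2 \<le> a then (a - 1) choose (a - card T2) else 0)
        * (((1 + p) ^ card T2) * p ^ (card S' - card T2))"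
      by simp
  qed
  finally show ?thesis .
qed

text \<open>
  The series is \<open>(\<Sum>a\<ge>1. w ^ a * X ^ a) ^ k\<close>, since the binomial coefficient counts the compositions
  of \<open>a\<close> into \<open>k\<close> parts.
\<close>

lemma one_minus_X_power_exc_series:
  fixes w :: "'a::comm_ring_1"
  shows "(1 - fps_const w * fps_X) ^ k *
      Abs_fps (\<lambda>a. w ^ a * of_nat (if k \<le> a then (a - 1) choose (a - k) else 0)) =
    (fps_const w * fps_X) ^ k"
proof (induction k)
  case 0
  show ?case
    by (rule fps_ext) (simp add: fps_one_nth binomial_eq_0)
next
  case (Suc k)
  let ?y = "fps_const w * fps_X"
  define c where "c = (\<lambda>k a. if k \<le> a then (a - 1) choose (a - k) else 0 :: nat)"
  let ?Y = "\<lambda>k. Abs_fps (\<lambda>a. w ^ a * of_nat (c k a))"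
  have step: "(1 - ?y) * ?Y (Suc k) = ?y * ?Y k"
  proof (rule fps_ext)
    fix n
    have pascal: "c (Suc k) (Suc m) = c (Suc k) m + c k m" for m
    proof (cases m)
      case (Suc m')
      consider "k = m" | "k < m" | "m < k"
        by linarith
      then show ?thesis
        by cases (auto simp: Suc Suc_diff_le c_def)
    qed (auto simp: c_def)
    moreover have "c (Suc k) 0 = 0"
      by (simp add: c_def)
    ultimately show "((1 - ?y) * ?Y (Suc k)) $ n = (?y * ?Y k) $ n"
      by (cases n) (simp_all add: left_diff_distrib mult.assoc distrib_left)
  qed
  have "(1 - ?y) ^ Suc k * ?Y (Suc k) = ?y * ((1 - ?y) ^ k * ?Y k)"
    unfolding power_Suc2 mult.assoc step by (simp only: mult_ac)
  then show ?case
    using Suc.IH by (simp add: c_def)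
qed

lemma fps_nth_mult_sum_of_nat:
  "(\<Sum>S\<in>A. of_nat (m S) * (G * f S) $ M) = (G * (\<Sum>S\<in>A. of_nat (m S) * f S)) $ M"
  for G :: "'a::comm_semiring_1 fps"
proof -
  have "(G * (of_nat (m S) * f S)) $ M = of_nat (m S) * (G * f S) $ M" for S
    by (simp only: mult.left_commute[of G] fps_mult_of_nat_nth)
  then show ?thesis
    by (simp add: sum_distrib_left fps_sum_nth)
qed

text \<open>
  Each value crossing the new cut either crossed the old one, with factor \<open>p\<close>, or belongs to the
  block. By \<open>sum_ext_count_0\<close> and \<open>one_minus_X_power_exc_series\<close>, \<open>k\<close> values of the second sort
  contribute \<open>((1 + p) w X / (1 - w X)) ^ k\<close>, and the binomial theorem turns the sum over all choices
  into a power of \<open>p' = p + (1 + p) w X / (1 - w X)\<close>.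
\<close>

lemma block_transfer_exc:
  fixes w :: "'a::comm_ring_1"
  assumes S': "finite S'" "S' \<subseteq> {N'..}"
    and p: "(1 - fps_const w * fps_X) * (1 + p') = 1 + p"
  shows "block_transfer 0 w (geom_value G p) N' S' = geom_value G p' N' S'"
proof -
  let ?y = "fps_const w * fps_X"
  let ?c = "\<lambda>k a. if k \<le> a then (a - 1) choose (a - k) else 0"
  let ?Y = "\<lambda>k. Abs_fps (\<lambda>a. w ^ a * of_nat (?c k a))"
  let ?F = "\<lambda>T. (1 + p) ^ card T * p ^ (card S' - card T)"
  have "block_transfer 0 w (geom_value G p) N' S' =
      (\<Sum>a\<le>N'. \<Sum>T\<in>Pow S'. (w ^ a * of_nat (?c (card T) a)) * (G * ?F T) $ (N' - a))"
    unfolding block_transfer_def geom_value_def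
  proof (rule sum.cong[OF refl])
    fix a assume "a \<in> {..N'}"
    then have "(\<Sum>S\<in>Pow ({N' - a..<N'} \<union> S'). of_nat (ext_count 0 (N' - a) a S S') * p ^ card S) =
        (\<Sum>T\<in>Pow S'. of_nat (?c (card T) a) * ?F T)"
      using sum_ext_count_0[of S' "N' - a" a p] S' by simp
    then show "w ^ a * (\<Sum>S\<in>Pow ({N' - a..<N'} \<union> S').
        of_nat (ext_count 0 (N' - a) a S S') * (G * p ^ card S) $ (N' - a)) =
        (\<Sum>T\<in>Pow S'. (w ^ a * of_nat (?c (card T) a)) * (G * ?F T) $ (N' - a))"
      unfolding fps_nth_mult_sum_of_nat mult.assoc[of "w ^ a"] sum_distrib_left[symmetric] by simp
  qed
  also have "\<dots> = (\<Sum>T\<in>Pow S'. (?Y (card T) * (G * ?F T)) $ N')"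
    by (subst sum.swap) (simp only: sum_shifted_nth)
  also have "\<dots> = (G * (\<Sum>T\<in>Pow S'. (?y * (1 + p')) ^ card T * p ^ (card S' - card T))) $ N'"
  proof -
    have term_T: "?Y (card T) * (G * ?F T) = G * ((?y * (1 + p')) ^ card T * p ^ (card S' - card T))" for T
    proof -
      have "?Y (card T) * (1 + p) ^ card T = ((1 - ?y) ^ card T * ?Y (card T)) * (1 + p') ^ card T"
        unfolding p[symmetric] power_mult_distrib by (simp only: mult_ac)
      also have "\<dots> = (?y * (1 + p')) ^ card T"
        unfolding one_minus_X_power_exc_series power_mult_distrib ..
      finally have *: "?Y (card T) * (1 + p) ^ card T = (?y * (1 + p')) ^ card T" .
      show ?thesis
        unfolding *[symmetric] by (simp only: mult_ac)
    qed
    show ?thesis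
      by (simp only: term_T sum_distrib_left fps_sum_nth)
  qed
  also have "\<dots> = (G * (?y * (1 + p') + p) ^ card S') $ N'"
    unfolding sum_Pow_weighted[OF S'(1)] ..
  also have "?y * (1 + p') + p = p'"
    using p by (simp add: algebra_simps)
  finally show ?thesis
    by (simp only: geom_value_def[of G p'])
qed

text \<open>
  Split the count according to whether the largest new value \<open>N + a - 1\<close> is in \<open>S\<close>, using Pascal's
  rule. The result is written as a difference of consecutive terms because its generating function is
  then \<open>1 - w X\<close> times a negative power.
\<close>

lemma sum_ext_count_1:
  fixes p :: "'a::comm_ring_1"
  assumes "finite S'" "S' \<subseteq> {N + a..}"
  shows "(\<Sum>S\<in>Pow ({N..<N + a} \<union> S'). of_nat (ext_count 1 N a S S') * p ^ card S) =
    p ^ card S' * (of_nat ((a + card S') choose a) * (1 + p) ^ a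
      - (if a = 0 then 0 else of_nat ((a - 1 + card S') choose (a - 1)) * (1 + p) ^ (a - 1)))"
proof (cases a)
  case 0
  have "(\<Sum>S\<in>Pow S'. of_nat (ext_count 1 N 0 S S') * p ^ card S) = (\<Sum>S\<in>Pow S'. if S = S' then p ^ card S' else 0)"
    using ext_count_0_length[OF _ assms(1), of _ 1 N] by (intro sum.cong) auto
  then show ?thesis
    using 0 assms(1) by simp
next
  case (Suc b)
  let ?h = "card S'" and ?e = "N + b"
  let ?P = "Pow ({N..<N + a} \<union> S')"
  have fin: "finite ?P"
    using assms(1) by simp
  have e: "?e \<notin> S'" "{N..<N + a} = insert ?e {N..<N + b}"
    using assms(2) Suc by auto
  have pascal: "(a + ?h) choose a = ((b + ?h) choose a) + ((b + ?h) choose b)"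
    using Suc by simp
  \<comment> \<open>The second summand is the surplus of \<open>(a + ?h) choose a\<close> over \<open>(b + ?h) choose a\<close>.\<close>
  have split: "of_nat (ext_count 1 N a S S') * p ^ card S =
      (if S' \<subseteq> S then of_nat ((b + ?h) choose a) * p ^ card S else 0) +
      (if insert ?e S' \<subseteq> S then of_nat ((b + ?h) choose b) * p ^ card S else 0)" for S
    using Suc pascal by (auto simp: ext_count_def algebra_simps)
  have "(\<Sum>S\<in>?P. of_nat (ext_count 1 N a S S') * p ^ card S) =
      of_nat ((b + ?h) choose a) * (\<Sum>S | S \<in> ?P \<and> S' \<subseteq> S. p ^ card S) +
      of_nat ((b + ?h) choose b) * (\<Sum>S | S \<in> ?P \<and> insert ?e S' \<subseteq> S. p ^ card S)"
    by (simp only: split sum.distrib sum_distrib_left) (simp only: sum.inter_filter[OF fin])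
  also have "{S. S \<in> ?P \<and> S' \<subseteq> S} = {S. S' \<subseteq> S \<and> S \<subseteq> {N..<N + a} \<union> S'}"
    by blast
  also have "(\<Sum>S\<in>\<dots>. p ^ card S) = p ^ ?h * (1 + p) ^ a"
    by (subst sum_between_power) (use assms in auto)
  also have "{S. S \<in> ?P \<and> insert ?e S' \<subseteq> S} =
      {S. insert ?e S' \<subseteq> S \<and> S \<subseteq> {N..<N + b} \<union> insert ?e S'}"
    unfolding e(2) by blast
  also have "(\<Sum>S\<in>\<dots>. p ^ card S) = p ^ Suc ?h * (1 + p) ^ b"
    by (subst sum_between_power) (use assms Suc e(1) in auto)
  finally show ?thesis
    using Suc pascal by (simp add: algebra_simps)
qed

text \<open>
  The binomial series of \<open>(1 - X) ^ (- (h + 1))\<close>.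
\<close>

lemma one_minus_X_power_binomial_series:
  "(1 - fps_X) ^ Suc h * Abs_fps (\<lambda>a. of_nat ((a + h) choose a)) = (1 :: 'a::comm_ring_1 fps)"
proof (induction h)
  case 0
  show ?case
  proof (rule fps_ext)
    fix n show "((1 - fps_X) ^ Suc 0 * Abs_fps (\<lambda>a. of_nat ((a + 0) choose a))) $ n = (1 :: 'a fps) $ n"
      by (cases n) (simp_all add: left_diff_distrib)
  qed
next
  case (Suc h)
  let ?R = "\<lambda>h. Abs_fps (\<lambda>a. of_nat ((a + h) choose a)) :: 'a fps"
  have "(1 - fps_X) * ?R (Suc h) = ?R h"
  proof (rule fps_ext)
    fix n show "((1 - fps_X) * ?R (Suc h)) $ n = ?R h $ n"
      by (cases n) (simp_all add: left_diff_distrib)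
  qed
  then have "(1 - fps_X) ^ Suc (Suc h) * ?R (Suc h) = (1 - fps_X) ^ Suc h * ?R h"
    by (simp only: power_Suc2[of _ "Suc h"] mult.assoc)
  then show ?case
    using Suc.IH by simp
qed

text \<open>
  Read off the coefficient of \<open>X ^ n\<close> in \<open>F * (\<Sum>a. c a * (w X P) ^ a)\<close>.
\<close>

lemma sum_shifted_compose_nth:
  fixes F P :: "'a::comm_ring_1 fps"
  shows "(\<Sum>a\<le>n. w ^ a * (c a * (F * P ^ a) $ (n - a))) =
    (F * (Abs_fps c oo (fps_const w * fps_X * P))) $ n"
proof -
  let ?z = "fps_const w * fps_X * P"
  have z0: "?z $ 0 = 0"
    by (simp only: fps_mult_nth_0 fps_X_nth) simp
  have "(F * ?z ^ a) $ n = w ^ a * (F * P ^ a) $ (n - a)" if "a \<le> n" for a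
  proof -
    have "F * ?z ^ a = fps_const (w ^ a) * (fps_X ^ a * (F * P ^ a))"
      by (simp add: power_mult_distrib mult_ac)
    then show ?thesis
      using that by (simp add: fps_X_power_mult_nth)
  qed
  then have "(\<Sum>a\<le>n. w ^ a * (c a * (F * P ^ a) $ (n - a))) = (\<Sum>a\<le>n. c a * (F * ?z ^ a) $ n)"
    by (intro sum.cong) (auto simp: mult_ac)
  also have "\<dots> = (\<Sum>a\<le>n. \<Sum>i\<le>n. F $ i * (c a * (?z ^ a) $ (n - i)))"
    by (simp add: fps_mult_nth sum_distrib_left atMost_atLeast0 mult_ac)
  also have "\<dots> = (\<Sum>i\<le>n. F $ i * (\<Sum>a\<le>n. c a * (?z ^ a) $ (n - i)))"
    by (subst sum.swap) (simp add: sum_distrib_left)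
  also have "\<dots> = (\<Sum>i\<le>n. F $ i * (Abs_fps c oo ?z) $ (n - i))"
  proof (intro sum.cong refl arg_cong[where f = "(*) _"])
    fix i
    have "(\<Sum>a\<le>n. c a * (?z ^ a) $ (n - i)) = (\<Sum>a\<le>n - i. c a * (?z ^ a) $ (n - i))"
      using startsby_zero_power_prefix[OF z0] by (intro sum.mono_neutral_right) auto
    then show "(\<Sum>a\<le>n. c a * (?z ^ a) $ (n - i)) = (Abs_fps c oo ?z) $ (n - i)"
      by (simp add: fps_compose_nth atMost_atLeast0)
  qed
  also have "\<dots> = (F * (Abs_fps c oo ?z)) $ n"
    by (simp add: fps_mult_nth atMost_atLeast0)
  finally show ?thesis .
qed

text \<open>
  Adding a block of antiexcedances replaces \<open>p\<close> by \<open>p / u\<close> and \<open>G\<close> by \<open>G (1 - w X) / u\<close>, where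
  \<open>u = 1 - w X (1 + p)\<close>, by the negative binomial series in \<open>w X (1 + p)\<close>.
\<close>

lemma block_transfer_antiexc:
  fixes w :: "'a::idom"
  assumes S': "finite S'" "S' \<subseteq> {N'..}"
    and p: "(1 - fps_const w * fps_X * (1 + p)) * p' = p"
    and G: "(1 - fps_const w * fps_X * (1 + p)) * G' = (1 - fps_const w * fps_X) * G"
  shows "block_transfer 1 w (geom_value G p) N' S' = geom_value G' p' N' S'"
proof -
  let ?h = "card S'" and ?y = "fps_const w * fps_X" and ?P = "1 + p"
  let ?r = "\<lambda>a. of_nat ((a + ?h) choose a) :: 'a"
  let ?F = "G * p ^ ?h"
  let ?R = "Abs_fps ?r oo (?y * ?P)"
  let ?s = "\<lambda>a n. w ^ a * (?r a * (?F * ?P ^ a) $ (n - a))"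
  have inner: "(\<Sum>S\<in>Pow ({N' - a..<N'} \<union> S').
        of_nat (ext_count 1 (N' - a) a S S') * (G * p ^ card S) $ (N' - a)) =
      ?r a * (?F * ?P ^ a) $ (N' - a) - (if a = 0 then 0 else ?r (a - 1) * (?F * ?P ^ (a - 1)) $ (N' - a))"
    if "a \<le> N'" for a
  proof -
    have "(\<Sum>S\<in>Pow ({N' - a..<N'} \<union> S').
        of_nat (ext_count 1 (N' - a) a S S') * (G * p ^ card S) $ (N' - a)) =
      (G * (\<Sum>S\<in>Pow ({N' - a..<N'} \<union> S'). of_nat (ext_count 1 (N' - a) a S S') * p ^ card S)) $ (N' - a)"
      by (rule fps_nth_mult_sum_of_nat)
    also have "\<dots> = (of_nat ((a + ?h) choose a) * (?F * ?P ^ a)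
        - (if a = 0 then 0 else of_nat ((a - 1 + ?h) choose (a - 1)) * (?F * ?P ^ (a - 1)))) $ (N' - a)"
      using sum_ext_count_1[of S' "N' - a" a p] S' that by (simp add: right_diff_distrib mult_ac)
    finally show ?thesis
      by simp
  qed
  have "block_transfer 1 w (geom_value G p) N' S' =
      (\<Sum>a\<le>N'. ?s a N') - (\<Sum>a\<le>N'. if a = 0 then 0 else w ^ a * (?r (a - 1) * (?F * ?P ^ (a - 1)) $ (N' - a)))"
    unfolding block_transfer_def geom_value_def sum_subtractf[symmetric]
  proof (intro sum.cong refl)
    fix a assume "a \<in> {..N'}"
    then have "a \<le> N'"
      by simp
    then show "w ^ a * (\<Sum>S\<in>Pow ({N' - a..<N'} \<union> S').
        of_nat (ext_count 1 (N' - a) a S S') * (G * p ^ card S) $ (N' - a)) =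
      ?s a N' - (if a = 0 then 0 else w ^ a * (?r (a - 1) * (?F * ?P ^ (a - 1)) $ (N' - a)))"
      unfolding inner[OF \<open>a \<le> N'\<close>] by (cases "a = 0") (simp_all add: right_diff_distrib)
  qed
  also have "(\<Sum>a\<le>N'. ?s a N') = (?F * ?R) $ N'"
    by (rule sum_shifted_compose_nth)
  also have "(\<Sum>a\<le>N'. if a = 0 then 0 else w ^ a * (?r (a - 1) * (?F * ?P ^ (a - 1)) $ (N' - a))) =
      (?y * (?F * ?R)) $ N'"
  proof (cases N')
    case (Suc n)
    have "(\<Sum>a\<le>N'. if a = 0 then 0 else w ^ a * (?r (a - 1) * (?F * ?P ^ (a - 1)) $ (N' - a))) =
        w * (\<Sum>a\<le>n. ?s a n)"
      unfolding Suc sum.atMost_Suc_shift by (simp add: sum_distrib_left mult.assoc)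
    also have "(\<Sum>a\<le>n. ?s a n) = (?F * ?R) $ n"
      by (rule sum_shifted_compose_nth)
    finally show ?thesis
      by (simp add: Suc mult.assoc)
  qed (simp add: mult.assoc)
  finally have "block_transfer 1 w (geom_value G p) N' S' = ((1 - ?y) * G * p ^ ?h * ?R) $ N'"
    by (simp add: left_diff_distrib mult.assoc)
  also have "(1 - ?y) * G * p ^ ?h * ?R = G' * p' ^ ?h"
  proof -
    let ?u = "1 - ?y * ?P"
    have "((1 - fps_X) ^ Suc ?h * Abs_fps ?r) oo (?y * ?P) = 1"
      by (simp only: one_minus_X_power_binomial_series fps_compose_1)
    then have R: "?u ^ Suc ?h * ?R = 1"
      by (simp add: fps_compose_mult_distrib fps_compose_power[symmetric] fps_compose_sub_distrib
          del: power_Suc)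
    have "(1 - ?y) * G * p ^ ?h * ?R = (?u * G') * (?u * p') ^ ?h * ?R"
      by (simp only: p G)
    also have "\<dots> = G' * p' ^ ?h * (?u ^ Suc ?h * ?R)"
      by (simp add: power_mult_distrib mult_ac)
    finally show ?thesis
      by (simp only: R mult_1_right)
  qed
  finally show ?thesis
    by (simp only: geom_value_def[of G' p'])
qed

text \<open>
  Fixed points do not interact with the values crossing the cut, so a block of them just contributes
  a geometric series.
\<close>

lemma block_transfer_fix:
  fixes w :: "'a::comm_ring_1"
  assumes S': "finite S'" and G: "(1 - fps_const w * fps_X) * G' = G"
  shows "block_transfer 2 w (geom_value G p) N' S' = geom_value G' p N' S'"
proof -
  let ?y = "fps_const w * fps_X"
  have "block_transfer 2 w (geom_value G p) N' S' = (\<Sum>a\<le>N'. w ^ a * (G * p ^ card S') $ (N' - a))"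
    unfolding block_transfer_def
  proof (intro sum.cong refl arg_cong[where f = "(*) _"])
    fix a
    have "(\<Sum>S\<in>Pow ({N' - a..<N'} \<union> S'). of_nat (ext_count 2 (N' - a) a S S') * geom_value G p (N' - a) S) =
        (\<Sum>S\<in>Pow ({N' - a..<N'} \<union> S'). if S = S' then geom_value G p (N' - a) S' else 0)"
      by (intro sum.cong) (auto simp: ext_count_def)
    then show "(\<Sum>S\<in>Pow ({N' - a..<N'} \<union> S'). of_nat (ext_count 2 (N' - a) a S S') * geom_value G p (N' - a) S) =
        (G * p ^ card S') $ (N' - a)"
      using S' by (simp add: geom_value_def)
  qed
  also have "\<dots> = ((1 - ?y) * Abs_fps (\<lambda>a. w ^ a) * (G' * p ^ card S')) $ N'"
    unfolding sum_shifted_nth G[symmetric] by (simp add: mult_ac)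
  also have "(1 - ?y) * Abs_fps (\<lambda>a. w ^ a) = 1"
  proof (rule fps_ext)
    fix n show "((1 - ?y) * Abs_fps (\<lambda>a. w ^ a)) $ n = 1 $ n"
      by (cases n) (simp_all add: left_diff_distrib mult.assoc)
  qed
  finally show ?thesis
    by (simp only: geom_value_def[of G' p] mult_1_left)
qed

section \<open>The generating function of the word weights\<close>

lemma sum_stage_Suc:
  fixes q :: "'a::field"
  assumes "\<And>i. i > 0 \<Longrightarrow> q ^ i \<noteq> 1" and "finite S" "S \<subseteq> {N..}" "j < 3"
  shows "(\<Sum>xs\<in>partials N S. stage q c (Suc j) xs) =
    block_transfer j (c j) (\<lambda>N S. \<Sum>xs\<in>partials N S. stage q c j xs) N S"
proof -
  have "(\<Sum>xs\<in>partials N S. stage q c (Suc j) xs) = (\<Sum>xs\<in>partials N S. peel j (c j) (stage q c j) xs)"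
    by (intro sum.cong refl peel_stage[OF assms(1), symmetric]) (auto simp: partials_def)
  then show ?thesis
    using sum_peel_eq_block_transfer[OF assms(2-4)] by metis
qed

text \<open>
  Adding the three kinds of blocks in turn leads from stage \<open>0\<close> to stage \<open>3\<close>, and stage \<open>0\<close> is
  \<open>q ^ N\<close> times stage \<open>3\<close>. These relations determine all stages: a first difference between two
  solutions, at length \<open>N > 0\<close>, would by \<open>block_transfer_diff\<close> be the same in each stage, hence
  equal to \<open>q ^ N\<close> times itself.
\<close>

lemma block_transfer_cycle_unique:
  fixes V W :: "nat \<Rightarrow> nat \<Rightarrow> nat set \<Rightarrow> 'a::idom"
  assumes q: "\<And>i. i > 0 \<Longrightarrow> q ^ i \<noteq> 1"
    and V: "\<And>j N S. \<lbrakk>j < 3; finite S; S \<subseteq> {N..}\<rbrakk> \<Longrightarrow> V (Suc j) N S = block_transfer j (c j) (V j) N S"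
    and W: "\<And>j N S. \<lbrakk>j < 3; finite S; S \<subseteq> {N..}\<rbrakk> \<Longrightarrow> W (Suc j) N S = block_transfer j (c j) (W j) N S"
    and V0: "\<And>N S. V 0 N S = q ^ N * V 3 N S"
    and W0: "\<And>N S. W 0 N S = q ^ N * W 3 N S"
    and base: "\<And>S. finite S \<Longrightarrow> V 3 0 S = W 3 0 S"
  shows "\<lbrakk>finite S; S \<subseteq> {N..}; j \<le> 3\<rbrakk> \<Longrightarrow> V j N S = W j N S"
proof (induction N arbitrary: S j rule: less_induct)
  case (less N)
  have step: "V (Suc j) N S - W (Suc j) N S = V j N S - W j N S" if "j < 3" for j
    unfolding V[OF that less.prems(1,2)] W[OF that less.prems(1,2)]
    by (rule block_transfer_diff) (use less that in auto)
  have const: "V j N S - W j N S = V 0 N S - W 0 N S" if "j \<le> 3" for j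
    using that by (induction j) (auto simp: step)
  have diff: "V j N S - W j N S = q ^ N * (V 3 N S - W 3 N S)" if "j \<le> 3" for j
    unfolding right_diff_distrib V0[symmetric] W0[symmetric] by (rule const[OF that])
  have "V 3 N S = W 3 N S"
  proof (cases "N = 0")
    case False
    have "(1 - q ^ N) * (V 3 N S - W 3 N S) = 0"
      using diff[of 3] by (simp add: left_diff_distrib)
    then show ?thesis
      using q[of N] False by simp
  qed (use base less.prems in simp)
  then show ?case
    using diff[OF less.prems(3)] by simp
qed

text \<open>
  The \<open>q\<close>-exponential series at \<open>s X\<close>, up to the normalisation of \<open>X\<close> by \<open>1 - q\<close>.
\<close>

definition qexp :: "'a::field \<Rightarrow> 'a \<Rightarrow> 'a fps" where
  "qexp q s = Abs_fps (\<lambda>n. s ^ n / qpoch q n)"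

lemma qexp_scale:
  fixes q :: "'a::field"
  assumes "\<And>i. i > 0 \<Longrightarrow> q ^ i \<noteq> 1"
  shows "qexp q s oo (fps_const q * fps_X) = (1 - fps_const s * fps_X) * qexp q s"
proof (rule fps_ext)
  fix n
  show "(qexp q s oo (fps_const q * fps_X)) $ n = ((1 - fps_const s * fps_X) * qexp q s) $ n"
  proof (cases n)
    case (Suc m)
    have "1 - q ^ Suc m \<noteq> 0" "qpoch q m \<noteq> 0"
      using assms[of "Suc m"] qpoch_nonzero[OF assms] by auto
    then show ?thesis
      unfolding fps_compose_linear
      by (simp add: Suc qexp_def left_diff_distrib mult.assoc qpoch_Suc divide_simps del: power_Suc)
        (simp add: algebra_simps)
  qed (simp add: qexp_def)
qed

definition kind_value :: "'a::one \<Rightarrow> 'a \<Rightarrow> nat \<Rightarrow> 'a" where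
  "kind_value t r j = (if j = 0 then t else if j = 1 then 1 else r)"

lemma partials_0: "partials 0 S = (if S = {} then {[]} else {})"
  by (auto simp: partials_def)

text \<open>
  By uniqueness it suffices to exhibit geometric families that solve the same relations. The
  substitution \<open>X \<mapsto> q X\<close> followed by the three transformations of \<open>1 + p\<close> has the fixed point
  \<open>(1 - t) H(t) / D\<close> with \<open>D = H(t) - t H(1)\<close>, where \<open>H(s) = qexp q s\<close> obeys \<open>H(s)(q X) = (1 - s X) H(s)\<close>.
  The corresponding fixed \<open>G\<close> is \<open>(1 - t) H(r) / D\<close>.
\<close>

lemma sum_word_weight_series:
  fixes q :: "'a::field"
  assumes q: "\<And>i. i > 0 \<Longrightarrow> q ^ i \<noteq> 1" and t: "t \<noteq> 1"
  shows "Abs_fps (\<lambda>N. \<Sum>xs\<in>partials N {}. word_weight q (kind_value t r) xs)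
      * (qexp q t - fps_const t * qexp q 1) = fps_const (1 - t) * qexp q r"
proof -
  let ?z = "fps_const q * fps_X" and ?k = "fps_const (1 - t)"
  let ?y = "\<lambda>s. 1 - fps_const s * fps_X"
  let ?H = "qexp q"
  define D where "D = ?H t - fps_const t * ?H 1"
  define D' where "D' = ?y t * ?H t - fps_const t * (?y 1 * ?H 1)"
  have H0: "?H s $ 0 = 1" for s
    by (simp add: qexp_def qpoch_def)
  have D: "D * inverse D = 1" "D' * inverse D' = 1"
    by (rule inverse_mult_eq_1', use t in \<open>simp add: D_def D'_def H0\<close>)+
  have DD': "D' - ?k * (fps_X * ?H t) = (1 - fps_X) * D"
    by (simp add: D_def D'_def algebra_simps flip: fps_const_sub)
  \<comment> \<open>\<open>P j - 1\<close> and \<open>G j\<close> describe stage \<open>j\<close>; \<open>D'\<close> is \<open>D\<close> at \<open>q X\<close>.\<close>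
  define P :: "nat \<Rightarrow> 'a fps" where "P = (\<lambda>j. ?k * (if j = 0 then ?y t * ?H t * inverse D'
      else if j = 1 then ?H t * inverse D' else ?H t * inverse D))"
  define G :: "nat \<Rightarrow> 'a fps" where "G = (\<lambda>j. ?k * (if j = 0 \<or> j = 1 then ?y r * ?H r * inverse D'
      else if j = 2 then ?y r * ?H r * inverse D else ?H r * inverse D))"
  define V where "V = (\<lambda>j. geom_value (G j) (P j - 1))"
  let ?c = "kind_value t r"
  define W where "W = (\<lambda>j N S. \<Sum>xs\<in>partials N S. stage q ?c j xs)"
  have u: "1 - fps_X * P 1 = (1 - fps_X) * (D * inverse D')"
  proof -
    have "1 - fps_X * P 1 = D' * inverse D' - ?k * (fps_X * ?H t) * inverse D'"
      by (simp add: P_def D mult_ac)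
    also have "\<dots> = (1 - fps_X) * D * inverse D'"
      unfolding DD'[symmetric] by (simp add: left_diff_distrib)
    finally show ?thesis
      by (simp add: mult.assoc)
  qed
  have P: "P 0 = ?y t * P 1" "(1 - fps_X * P 1) * (P 2 - 1) = P 1 - 1" "P 3 = P 2"
  proof -
    have "(1 - fps_X * P 1) * P 2 = (1 - fps_X) * ?k * ?H t * inverse D' * (D * inverse D)"
      unfolding u by (simp add: P_def mult_ac)
    also have "\<dots> = P 1 - fps_X * P 1"
      by (simp add: D P_def algebra_simps)
    finally show "(1 - fps_X * P 1) * (P 2 - 1) = P 1 - 1"
      by (simp add: algebra_simps)
  qed (simp_all add: P_def mult_ac)
  have G: "G 1 = G 0" "(1 - fps_X * P 1) * G 2 = (1 - fps_X) * G 1" "?y r * G 3 = G 2"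
  proof -
    have "(1 - fps_X * P 1) * G 2 = (1 - fps_X) * ?k * (?y r * ?H r) * inverse D' * (D * inverse D)"
      unfolding u by (simp add: G_def mult_ac)
    then show "(1 - fps_X * P 1) * G 2 = (1 - fps_X) * G 1"
      by (simp add: D G_def mult_ac)
  qed (simp_all add: G_def mult_ac)
  have stepV: "V (Suc j) N S = block_transfer j (?c j) (V j) N S" if "j < 3" "finite S" "S \<subseteq> {N..}" for j N S
  proof -
    consider "j = 0" | "j = 1" | "j = 2"
      using \<open>j < 3\<close> by linarith
    then show ?thesis
    proof cases
      case 1
      have "block_transfer 0 t (geom_value (G 0) (P 0 - 1)) N S = geom_value (G 0) (P 1 - 1) N S"
        by (rule block_transfer_exc) (use that P(1) in simp_all)
      then show ?thesis
        using 1 G(1) by (simp add: V_def kind_value_def)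
    next
      case 2
      have "block_transfer 1 1 (geom_value (G 1) (P 1 - 1)) N S = geom_value (G 2) (P 2 - 1) N S"
        by (rule block_transfer_antiexc) (use that P(2) G(2) in simp_all)
      then show ?thesis
        using 2 by (simp add: V_def kind_value_def numeral_2_eq_2)
    next
      case 3
      have "block_transfer 2 r (geom_value (G 2) (P 2 - 1)) N S = geom_value (G 3) (P 2 - 1) N S"
        by (rule block_transfer_fix) (use that G(3) in simp_all)
      then show ?thesis
        using 3 P(3) by (simp add: V_def kind_value_def)
    qed
  qed
  have scaleV: "V 0 N S = q ^ N * V 3 N S" for N S
  proof -
    have z: "?z $ 0 = 0"
      by simp
    note hom = fps_compose_mult_distrib[OF z] fps_compose_sub_distrib fps_compose_power[OF z, symmetric]
    have "D oo ?z = D'"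
      by (simp add: D_def D'_def hom qexp_scale[OF q])
    then have "D' * (inverse D oo ?z) = 1"
      using arg_cong[OF D(1), of "\<lambda>f. f oo ?z"] by (simp add: hom)
    then have "inverse D' * (D' * (inverse D oo ?z)) = inverse D'"
      by simp
    then have "inverse D oo ?z = inverse D'"
      using D(2) by (simp add: mult.assoc[symmetric] mult.commute[of "inverse D'" D'])
    then have "G 3 oo ?z = G 0" "(P 3 - 1) oo ?z = P 0 - 1"
      by (simp_all add: G_def P_def hom qexp_scale[OF q] mult.assoc)
    then have "G 0 * (P 0 - 1) ^ card S = (G 3 * (P 3 - 1) ^ card S) oo ?z"
      by (simp add: hom)
    then show ?thesis
      by (simp add: V_def geom_value_def fps_compose_linear)
  qed
  have baseVW: "V 3 0 S = W 3 0 S" if "finite S" for S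
  proof -
    have "G 3 $ 0 = 1" "(P 3 - 1) $ 0 = 0"
      using t by (simp_all add: G_def P_def D_def H0)
    then have "V 3 0 S = (if S = {} then 1 else 0)"
      using that by (simp add: V_def geom_value_def power_0_left fps_nth_power_0)
    moreover have "W 3 0 S = (if S = {} then 1 else 0)"
      by (simp add: W_def partials_0 stage_def word_weight_def dexsum_def kind_weight_def qpoch_def)
    ultimately show ?thesis
      by simp
  qed
  have stepW: "W (Suc j) N S = block_transfer j (?c j) (W j) N S"
    if "j < 3" "finite S" "S \<subseteq> {N..}" for j N S
    unfolding W_def by (rule sum_stage_Suc) (use q that in auto)
  have scaleW: "W 0 N S = q ^ N * W 3 N S" for N S
  proof -
    have "W 0 N S = (\<Sum>xs\<in>partials N S. q ^ N * word_weight q ?c xs)"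
      unfolding W_def stage_0 by (intro sum.cong) (auto simp: partials_def)
    then show ?thesis
      by (simp add: W_def stage_3 sum_distrib_left)
  qed
  have "V 3 N {} = W 3 N {}" for N
    by (rule block_transfer_cycle_unique[of q V ?c W, OF q stepV stepW scaleV scaleW baseVW]) auto
  then have "Abs_fps (\<lambda>N. \<Sum>xs\<in>partials N {}. word_weight q ?c xs) = G 3"
    by (intro fps_ext) (simp add: V_def W_def geom_value_def stage_3)
  also have "G 3 * D = ?k * ?H r * (D * inverse D)"
    by (simp add: G_def mult_ac)
  finally show ?thesis
    unfolding D(1) D_def[symmetric] by (simp only: mult_1_right)
qed

text \<open>
  Compare coefficients in the series identity: \<open>H(t) - t H(1)\<close> has coefficients
  \<open>(t ^ j - t) / qpoch q j\<close>, and \<open>t ^ j - t = - (1 - t) * t * qint t (j - 1)\<close> for \<open>j > 0\<close>.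
\<close>

lemma sum_word_weight_recurrence:
  fixes q t r :: "'a::field"
  assumes q: "\<And>i. i > 0 \<Longrightarrow> q ^ i \<noteq> 1" and t: "t \<noteq> 1"
  defines "w \<equiv> \<lambda>N. \<Sum>xs\<in>partials N {}. word_weight q (kind_value t r) xs"
  shows "w n = r ^ n / qpoch q n +
    (\<Sum>k | k + 2 \<le> n. w k * (t * qint t (n - k - 1)) / qpoch q (n - k))"
proof -
  have nz: "1 - t \<noteq> 0"
    using t by simp
  let ?d = "\<lambda>j. (t ^ j - t) / qpoch q j"
  let ?e = "\<lambda>k. w k * (t * qint t (n - k - 1)) / qpoch q (n - k)"
  have "(Abs_fps w * (qexp q t - fps_const t * qexp q 1)) $ n = (fps_const (1 - t) * qexp q r) $ n"
    unfolding w_def by (rule arg_cong[OF sum_word_weight_series[OF q t]])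
  then have *: "(\<Sum>k\<le>n. w k * ?d (n - k)) = (1 - t) * (r ^ n / qpoch q n)"
    unfolding fps_mult_nth[of "Abs_fps w"]
    by (simp add: qexp_def atMost_atLeast0 diff_divide_distrib)
  have summand: "w k * ?d (n - k) = - (1 - t) * ?e k" if "k < n" for k
  proof -
    have "t ^ (n - k) - t = - (1 - t) * (t * qint t (n - k - 1))"
    proof -
      have "(1 - t) * qint t m = 1 - t ^ m" for m
        by (simp add: qint_def one_diff_power_eq)
      then have "- (1 - t) * (t * qint t (n - k - 1)) = - t * (1 - t ^ (n - k - 1))"
        by (metis mult.left_commute mult_minus_left)
      also have "\<dots> = t * t ^ (n - k - 1) - t"
        by (simp add: algebra_simps)
      also have "t * t ^ (n - k - 1) = t ^ (n - k)"
        using that by (metis Suc_diff_Suc diff_Suc_1 diff_diff_left power_Suc plus_1_eq_Suc add.commute)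
      finally show ?thesis ..
    qed
    then show ?thesis
      by simp
  qed
  have "(\<Sum>k<n. w k * ?d (n - k)) = - (1 - t) * (\<Sum>k<n. ?e k)"
    unfolding sum_distrib_left by (rule sum.cong[OF refl]) (rule summand, simp)
  moreover have "(\<Sum>k\<le>n. w k * ?d (n - k)) = (\<Sum>k<n. w k * ?d (n - k)) + (1 - t) * w n"
    by (simp add: lessThan_Suc_atMost[symmetric] qpoch_def)
  ultimately have "(1 - t) * w n + - (1 - t) * (\<Sum>k<n. ?e k) = (1 - t) * (r ^ n / qpoch q n)"
    unfolding * by (simp only: add.commute)
  then have "(1 - t) * w n = (1 - t) * (r ^ n / qpoch q n) - - (1 - t) * (\<Sum>k<n. ?e k)"
    by (simp only: eq_diff_eq)
  then have "(1 - t) * w n = (1 - t) * (r ^ n / qpoch q n + (\<Sum>k<n. ?e k))"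
    by (simp only: distrib_left mult_minus_left diff_minus_eq_add)
  then have "w n = r ^ n / qpoch q n + (\<Sum>k<n. ?e k)"
    unfolding mult_left_cancel[OF nz] .
  also have "(\<Sum>k<n. ?e k) = (\<Sum>k | k + 2 \<le> n. ?e k)"
  proof (rule sum.mono_neutral_right)
    show "\<forall>k\<in>{..<n} - {k. k + 2 \<le> n}. ?e k = 0"
    proof
      fix k assume "k \<in> {..<n} - {k. k + 2 \<le> n}"
      then have "n - k - 1 = 0"
        by auto
      then show "?e k = 0"
        by (simp add: qint_def)
    qed
  qed auto
  finally show ?thesis .
qed

section \<open>From words to permutations\<close>

definition word_maj :: "nat list \<Rightarrow> nat" where
  "word_maj xs = (\<Sum>i<length xs. if 0 < i \<and> xs ! i < xs ! (i - 1) then i else 0)"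

definition kind_count :: "nat \<Rightarrow> nat list \<Rightarrow> nat" where
  "kind_count j xs = card {i. i < length xs \<and> kind i (xs ! i) = j}"

lemma word_maj_snoc:
  "word_maj (xs @ [v]) = word_maj xs + (if xs \<noteq> [] \<and> v < last xs then length xs else 0)"
proof -
  have "(\<Sum>i<length xs. if 0 < i \<and> (xs @ [v]) ! i < (xs @ [v]) ! (i - 1) then i else 0) = word_maj xs"
    unfolding word_maj_def by (intro sum.cong) (auto simp: nth_append)
  then show ?thesis
    by (auto simp: word_maj_def nth_append last_conv_nth)
qed

lemma kind_count_snoc:
  "kind_count j (xs @ [v]) = kind_count j xs + (if kind (length xs) v = j then 1 else 0)"
proof -
  have "{i. i < length (xs @ [v]) \<and> kind i ((xs @ [v]) ! i) = j} =
      {i. i < length xs \<and> kind i (xs ! i) = j} \<union> (if kind (length xs) v = j then {length xs} else {})"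
    by (auto simp: nth_append less_Suc_eq)
  then show ?thesis
    by (simp add: kind_count_def)
qed

lemma kind_weight_eq:
  "kind_weight (kind_value t r) xs = t ^ kind_count 0 xs * r ^ kind_count 2 xs"
proof (induction xs rule: rev_induct)
  case Nil
  show ?case
    by (simp add: kind_weight_def kind_count_def)
next
  case (snoc v xs)
  then show ?case
    by (simp add: kind_weight_snoc kind_count_snoc kind_value_def kind_def mult_ac)
qed

text \<open>
  Descents and barred descents differ exactly where an excedance and a non-excedance are neighbours.
  An excedance followed by a non-excedance is always a descent and never a barred descent; in the
  opposite order it is the other way round. So a maximal run of excedances on the places from \<open>i\<close> to
  \<open>j - 1\<close> contributes \<open>j - i\<close>, its length, to the difference of the major indices; for a run at the
  end of the word the contribution of its right end is the extra summand on the left.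
\<close>

lemma word_maj_eq:
  assumes "distinct xs"
  shows "word_maj xs + (if xs \<noteq> [] \<and> last_kind xs = 0 then length xs else 0) =
    dexsum xs + kind_count 0 xs"
  using assms
proof (induction xs rule: rev_induct)
  case Nil
  show ?case
    by (simp add: word_maj_def dexsum_def kind_count_def)
next
  case (snoc v xs)
  have lk: "last_kind (xs @ [v]) = kind (length xs) v"
    by (simp add: last_kind_def)
  show ?case
  proof (cases "xs = []")
    case True
    then show ?thesis
      unfolding lk word_maj_snoc dexsum_snoc kind_count_snoc
      by (simp add: word_maj_def dexsum_def kind_count_def kind_def)
  next
    case False
    then have "0 < length xs" "v \<noteq> last xs"
      using snoc.prems by auto
    then show ?thesis
      using snoc False
      by (simp add: lk word_maj_snoc dexsum_snoc kind_count_snoc)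
        (auto simp: last_kind_def kind_def split: if_splits)
  qed
qed

text \<open>
  A full permutation cannot end in an excedance, so \<open>maj = dexsum + exc\<close>; this is why the statistic
  \<open>exc\<close> is marked by \<open>t * q\<close> on the word side.
\<close>

lemma A_maj_exc_fix_eq_words:
  "A_maj_exc_fix n q t r =
    (\<Sum>xs\<in>partials n {}. q ^ dexsum xs * kind_weight (kind_value (t * q) r) xs)"
proof -
  define word :: "(nat \<Rightarrow> nat) \<Rightarrow> nat list" where "word = (\<lambda>\<sigma>. map (\<lambda>i. \<sigma> (Suc i) - 1) [0..<n])"
  define perm :: "nat list \<Rightarrow> nat \<Rightarrow> nat" where "perm = (\<lambda>xs i. if i \<in> {1..n} then Suc (xs ! (i - 1)) else i)"
  have partials: "partials n {} = {xs. length xs = n \<and> distinct xs \<and> set xs = {..<n}}"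
  proof -
    have "set xs = {..<n}" if "length xs = n" "distinct xs" "set xs \<subseteq> {..<n}" for xs
      using that by (metis card_lessThan card_subset_eq distinct_card finite_lessThan)
    then show ?thesis
      by (auto simp: partials_def)
  qed
  have word: "word \<sigma> \<in> partials n {}" "perm (word \<sigma>) = \<sigma>"
    and weight: "q ^ dexsum (word \<sigma>) * kind_weight (kind_value (t * q) r) (word \<sigma>) =
       q ^ maj n \<sigma> * t ^ exc n \<sigma> * r ^ fixpts n \<sigma>"
    if \<sigma>: "\<sigma> permutes {1..n}" for \<sigma>
  proof -
    have range: "\<sigma> i \<in> {1..n}" if "i \<in> {1..n}" for i
      using \<sigma> that by (metis permutes_in_image)
    have len: "length (word \<sigma>) = n"
      by (simp add: word_def)
    have nth: "Suc (word \<sigma> ! i) = \<sigma> (Suc i)" if "i < n" for i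
      using range[of "Suc i"] that by (simp add: word_def)
    have lt: "word \<sigma> ! i < n" if "i < n" for i
      using range[of "Suc i"] nth[OF that] that by auto
    have "inj_on (\<lambda>i. word \<sigma> ! i) {..<n}"
    proof (rule inj_onI)
      fix i j assume "i \<in> {..<n}" "j \<in> {..<n}" "word \<sigma> ! i = word \<sigma> ! j"
      then have "\<sigma> (Suc i) = \<sigma> (Suc j)"
        using nth by (metis lessThan_iff)
      then show "i = j"
        using injD[OF permutes_inj[OF \<sigma>]] by blast
    qed
    then have dist: "distinct (word \<sigma>)"
      unfolding distinct_conv_nth len by (auto dest: inj_onD)
    show "word \<sigma> \<in> partials n {}"
      using len dist lt by (auto simp: partials_def in_set_conv_nth)
    show "perm (word \<sigma>) = \<sigma>"
    proof
      fix i show "perm (word \<sigma>) i = \<sigma> i"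
        using nth[of "i - 1"] permutes_not_in[OF \<sigma>, of i] by (auto simp: perm_def)
    qed
    have maj: "word_maj (word \<sigma>) = maj n \<sigma>"
    proof -
      have "maj n \<sigma> = (\<Sum>i\<in>{i \<in> {..<n}. 0 < i \<and> word \<sigma> ! i < word \<sigma> ! (i - 1)}. i)"
        unfolding maj_def DES_def
      proof (rule sum.cong)
        have "\<sigma> (i + 1) < \<sigma> i \<longleftrightarrow> word \<sigma> ! i < word \<sigma> ! (i - 1)" if "0 < i" "i < n" for i
          using nth[of i] nth[of "i - 1"] that by (cases i) auto
        then show "{i \<in> {1..<n}. \<sigma> (i + 1) < \<sigma> i} =
            {i \<in> {..<n}. 0 < i \<and> word \<sigma> ! i < word \<sigma> ! (i - 1)}"
          by auto
      qed simp
      also have "\<dots> = word_maj (word \<sigma>)"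
        unfolding word_maj_def len by (rule sum.inter_filter) simp
      finally show ?thesis ..
    qed
    have exc: "kind_count 0 (word \<sigma>) = exc n \<sigma>"
    proof -
      have "Suc ` {i. i < n \<and> kind i (word \<sigma> ! i) = 0} = {i \<in> {1..<n}. \<sigma> i > i}"
      proof (intro equalityI subsetI)
        fix i assume "i \<in> {i \<in> {1..<n}. \<sigma> i > i}"
        moreover from this have "i - 1 < n"
          by auto
        ultimately show "i \<in> Suc ` {i. i < n \<and> kind i (word \<sigma> ! i) = 0}"
          using nth[of "i - 1"] by (intro image_eqI[of _ _ "i - 1"]) (auto simp: kind_def)
      next
        fix i assume "i \<in> Suc ` {i. i < n \<and> kind i (word \<sigma> ! i) = 0}"
        then obtain k where k: "i = Suc k" "k < n" "k < word \<sigma> ! k"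
          by (auto simp: kind_def split: if_splits)
        then show "i \<in> {i \<in> {1..<n}. \<sigma> i > i}"
          using nth[of k] lt[of k] by auto
      qed
      then have "card (Suc ` {i. i < n \<and> kind i (word \<sigma> ! i) = 0}) = exc n \<sigma>"
        by (simp only: exc_def)
      then show ?thesis
        by (simp add: card_image kind_count_def len)
    qed
    have fixed: "kind_count 2 (word \<sigma>) = fixpts n \<sigma>"
    proof -
      have "Suc ` {i. i < n \<and> kind i (word \<sigma> ! i) = 2} = {i \<in> {1..n}. \<sigma> i = i}"
      proof (intro equalityI subsetI)
        fix i assume "i \<in> {i \<in> {1..n}. \<sigma> i = i}"
        moreover from this have "i - 1 < n"
          by auto
        ultimately show "i \<in> Suc ` {i. i < n \<and> kind i (word \<sigma> ! i) = 2}"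
          using nth[of "i - 1"] by (intro image_eqI[of _ _ "i - 1"]) (auto simp: kind_def)
      next
        fix i assume "i \<in> Suc ` {i. i < n \<and> kind i (word \<sigma> ! i) = 2}"
        then obtain k where k: "i = Suc k" "k < n" "k = word \<sigma> ! k"
          by (auto simp: kind_def split: if_splits)
        then show "i \<in> {i \<in> {1..n}. \<sigma> i = i}"
          using nth[of k] by auto
      qed
      then have "card (Suc ` {i. i < n \<and> kind i (word \<sigma> ! i) = 2}) = fixpts n \<sigma>"
        by (simp only: fixpts_def)
      then show ?thesis
        by (simp add: card_image kind_count_def len)
    qed
    have "\<not> (word \<sigma> \<noteq> [] \<and> last_kind (word \<sigma>) = 0)"
    proof
      assume *: "word \<sigma> \<noteq> [] \<and> last_kind (word \<sigma>) = 0"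
      then have "n - 1 < word \<sigma> ! (n - 1)" "n > 0"
        using len by (auto simp: last_kind_def kind_def last_conv_nth split: if_splits)
      then show False
        using lt[of "n - 1"] by simp
    qed
    then have "maj n \<sigma> = dexsum (word \<sigma>) + exc n \<sigma>"
      using word_maj_eq[OF dist] maj exc by auto
    then show "q ^ dexsum (word \<sigma>) * kind_weight (kind_value (t * q) r) (word \<sigma>) =
       q ^ maj n \<sigma> * t ^ exc n \<sigma> * r ^ fixpts n \<sigma>"
      by (simp add: kind_weight_eq exc fixed power_mult_distrib power_add mult_ac)
  qed
  have perm: "perm xs permutes {1..n}" "word (perm xs) = xs" if xs: "xs \<in> partials n {}" for xs
  proof -
    have len: "length xs = n" and dist: "distinct xs" and set: "set xs = {..<n}"
      using xs by (auto simp: partials)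
    have "inj_on (perm xs) {1..n}"
    proof (rule inj_onI)
      fix i j assume "i \<in> {1..n}" "j \<in> {1..n}" "perm xs i = perm xs j"
      moreover from this have "i - 1 < length xs" "j - 1 < length xs"
        using len by auto
      ultimately have "i - 1 = j - 1"
        using nth_eq_iff_index_eq[OF dist] by (simp add: perm_def)
      then show "i = j"
        using \<open>i \<in> {1..n}\<close> \<open>j \<in> {1..n}\<close> by (simp add: eq_diff_iff)
    qed
    moreover have "perm xs ` {1..n} \<subseteq> {1..n}"
    proof
      fix v assume "v \<in> perm xs ` {1..n}"
      then obtain i where i: "i \<in> {1..n}" "v = Suc (xs ! (i - 1))"
        by (auto simp: perm_def)
      then have "i - 1 < length xs"
        using len by auto
      then have "xs ! (i - 1) < n"
        using set nth_mem by blast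
      then show "v \<in> {1..n}"
        using i by auto
    qed
    ultimately have "bij_betw (perm xs) {1..n} {1..n}"
      by (simp add: bij_betw_def endo_inj_surj)
    then show "perm xs permutes {1..n}"
      by (rule bij_imp_permutes) (auto simp: perm_def)
    show "word (perm xs) = xs"
      by (rule nth_equalityI) (simp_all add: word_def perm_def len)
  qed
  show ?thesis
    unfolding A_maj_exc_fix_def
    by (rule sum.reindex_bij_witness[of _ perm word]) (use word weight perm in auto)
qed

section \<open>The recurrence over the polynomial ring\<close>

lemma qpoch_eq_qfact: "qpoch q n = (1 - q) ^ n * qfact q n"
proof (induction n)
  case (Suc n)
  have "1 - q ^ Suc n = (1 - q) * qint q (Suc n)"
    unfolding qint_def by (rule one_diff_power_eq)
  then show ?case
    using Suc by (simp only: qpoch_Suc qfact_Suc power_Suc mult_ac)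
qed (simp add: qpoch_def)

lemma A_maj_exc_fix_recurrence_field:
  fixes q t r :: "'a::field"
  assumes q: "\<And>i. i > 0 \<Longrightarrow> q ^ i \<noteq> 1" and tq: "t * q \<noteq> 1"
  shows "A_maj_exc_fix n q t r = r ^ n +
    (\<Sum>k | k + 2 \<le> n. qfact q n / (qfact q k * qfact q (n - k)) * A_maj_exc_fix k q t r
       * (t * q * qint (t * q) (n - k - 1)))"
proof -
  let ?A = "\<lambda>n. A_maj_exc_fix n q t r" and ?c = "\<lambda>j. t * q * qint (t * q) (j - 1)"
  have nz: "qpoch q m \<noteq> 0" "1 - q \<noteq> 0" for m
    using qpoch_nonzero[OF q] q[of 1] by auto
  have words: "(\<Sum>xs\<in>partials m {}. word_weight q (kind_value (t * q) r) xs) = ?A m / qpoch q m" for m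
    unfolding A_maj_exc_fix_eq_words sum_divide_distrib
    by (intro sum.cong) (auto simp: word_weight_def partials_def)
  have "?A n / qpoch q n = r ^ n / qpoch q n +
      (\<Sum>k | k + 2 \<le> n. ?A k / qpoch q k * ?c (n - k) / qpoch q (n - k))"
    using sum_word_weight_recurrence[OF q tq, of r n] unfolding words .
  then have "?A n = r ^ n +
      qpoch q n * (\<Sum>k | k + 2 \<le> n. ?A k / qpoch q k * ?c (n - k) / qpoch q (n - k))"
    using nz(1)[of n] by (simp add: field_simps)
  also have "qpoch q n * (\<Sum>k | k + 2 \<le> n. ?A k / qpoch q k * ?c (n - k) / qpoch q (n - k)) =
      (\<Sum>k | k + 2 \<le> n. qfact q n / (qfact q k * qfact q (n - k)) * ?A k * ?c (n - k))"
    unfolding sum_distrib_left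
  proof (rule sum.cong[OF refl])
    fix k assume "k \<in> {k. k + 2 \<le> n}"
    then have "(1 - q) ^ n = (1 - q) ^ k * (1 - q) ^ (n - k)"
      by (simp add: power_add[symmetric])
    then have "qpoch q n / (qpoch q k * qpoch q (n - k)) = qfact q n / (qfact q k * qfact q (n - k))"
      using nz(2) by (simp add: qpoch_eq_qfact mult_ac)
    then have "qfact q n / (qfact q k * qfact q (n - k)) * ?A k * ?c (n - k) =
        qpoch q n / (qpoch q k * qpoch q (n - k)) * ?A k * ?c (n - k)"
      by (simp only:)
    then show "qpoch q n * (?A k / qpoch q k * ?c (n - k) / qpoch q (n - k)) =
        qfact q n / (qfact q k * qfact q (n - k)) * ?A k * ?c (n - k)"
      by (simp only: times_divide_eq_left times_divide_eq_right divide_divide_eq_left mult_ac)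
  qed
  finally show ?thesis .
qed

lemma to_fract_power: "to_fract (x ^ n) = to_fract x ^ n"
  by (induction n) simp_all

lemma to_fract_qint: "to_fract (qint u m) = qint (to_fract u) m"
  by (simp add: qint_def to_fract_power)

lemma to_fract_qfact: "to_fract (qfact u m) = qfact (to_fract u) m"
  by (induction m) (simp_all add: qfact_Suc to_fract_qint)

lemma to_fract_A_maj_exc_fix:
  "to_fract (A_maj_exc_fix n q t r) = A_maj_exc_fix n (to_fract q) (to_fract t) (to_fract r)"
  by (simp add: A_maj_exc_fix_def to_fract_power)

lemma to_fract_qbinomial:
  assumes "k \<le> n"
  shows "to_fract (qbinomial Xq n k) =
    qfact (to_fract Xq) n / (qfact (to_fract Xq) k * qfact (to_fract Xq) (n - k))"
proof -
  have "to_fract (qbinomial Xq n k) * (to_fract (qfact Xq k) * to_fract (qfact Xq (n - k))) = to_fract (qfact Xq n)"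
    unfolding to_fract_mult[symmetric] by (simp only: qbinomial_exact[OF assms])
  moreover have "to_fract (qfact Xq m) \<noteq> 0" for m
    by (simp add: qfact_Xq_nonzero)
  ultimately have "to_fract (qbinomial Xq n k) = to_fract (qfact Xq n) / (to_fract (qfact Xq k) * to_fract (qfact Xq (n - k)))"
    by (metis mult_eq_0_iff nonzero_eq_divide_eq)
  then show ?thesis
    by (simp only: to_fract_qfact)
qed

text \<open>
  The field recurrence holds in the fraction field of the polynomial ring, where the indeterminate
  \<open>q\<close> is not a root of unity and \<open>t q\<close> is not \<open>1\<close>; its \<open>q\<close>-binomial quotients agree with the exact
  divisions in the ring.
\<close>

lemma A_maj_exc_fix_recurrence:
  "A_maj_exc_fix n Xq Xt Xr = Xr ^ n +
    (\<Sum>k | k + 2 \<le> n. qbinomial Xq n k * A_maj_exc_fix k Xq Xt Xr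
       * (Xt * Xq * qint (Xt * Xq) (n - k - 1)))"
proof -
  let ?q = "to_fract Xq" and ?t = "to_fract Xt" and ?r = "to_fract Xr"
  have q: "?q ^ i \<noteq> 1" if "i > 0" for i
  proof
    assume "?q ^ i = 1"
    then have "Xq ^ i = 1"
      by (metis to_fract_1 to_fract_eq_iff to_fract_power)
    then have "poly (poly (poly (Xq ^ i) 0) 0) 2 = 1"
      by simp
    then have "(2::int) ^ i = 1"
      by (simp add: Xq_def)
    then show False
      using that by simp
  qed
  have tq: "?t * ?q \<noteq> 1"
  proof
    assume "?t * ?q = 1"
    then have "Xt * Xq = 1"
      by (metis to_fract_1 to_fract_eq_iff to_fract_mult)
    then have "poly (poly (poly (Xt * Xq) 0) 0) 0 = 1"
      by simp
    then show False
      by (simp add: Xt_def)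
  qed
  have "to_fract (A_maj_exc_fix n Xq Xt Xr) = A_maj_exc_fix n ?q ?t ?r"
    by (rule to_fract_A_maj_exc_fix)
  also have "\<dots> = ?r ^ n +
      (\<Sum>k | k + 2 \<le> n. qfact ?q n / (qfact ?q k * qfact ?q (n - k)) * A_maj_exc_fix k ?q ?t ?r
        * (?t * ?q * qint (?t * ?q) (n - k - 1)))"
    by (rule A_maj_exc_fix_recurrence_field[OF q tq])
  also have "\<dots> = to_fract (Xr ^ n +
    (\<Sum>k | k + 2 \<le> n. qbinomial Xq n k * A_maj_exc_fix k Xq Xt Xr
       * (Xt * Xq * qint (Xt * Xq) (n - k - 1))))"
    unfolding to_fract_add to_fract_sum to_fract_mult to_fract_power to_fract_qint to_fract_A_maj_exc_fix
    by (intro arg_cong2[where f = "(+)"] sum.cong refl) (simp add: to_fract_qbinomial)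
  finally have "to_fract (A_maj_exc_fix n Xq Xt Xr) = to_fract (Xr ^ n +
    (\<Sum>k | k + 2 \<le> n. qbinomial Xq n k * A_maj_exc_fix k Xq Xt Xr
       * (Xt * Xq * qint (Xt * Xq) (n - k - 1))))" .
  then show ?thesis
    by (simp only: to_fract_eq_iff)
qed

section \<open>Iterating the recurrence over compositions\<close>

lemma qmultinomial_singleton: "qmultinomial Xq n [n] = 1"
  using qfact_Xq_nonzero[of n] by (simp add: qmultinomial_def)

lemma qmultinomial_snoc:
  assumes "sum_list ks = k"
  shows "qmultinomial Xq (k + j) (ks @ [j]) = qbinomial Xq (k + j) k * qmultinomial Xq k ks"
proof -
  let ?p = "\<Prod>k\<leftarrow>ks. qfact Xq k"
  have "qmultinomial Xq (k + j) (ks @ [j]) * (?p * qfact Xq j) = qfact Xq (k + j)"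
    using qmultinomial_exact[of "ks @ [j]" "k + j"] assms by simp
  also have "\<dots> = qbinomial Xq (k + j) k * ((qmultinomial Xq k ks * ?p) * qfact Xq j)"
    using qbinomial_exact[of k "k + j"] qmultinomial_exact[OF assms] by simp
  finally have "qmultinomial Xq (k + j) (ks @ [j]) * (?p * qfact Xq j) =
      (qbinomial Xq (k + j) k * qmultinomial Xq k ks) * (?p * qfact Xq j)"
    by (simp only: mult_ac)
  moreover have "?p * qfact Xq j \<noteq> 0"
    by (auto simp: qfact_Xq_nonzero prod_list_zero_iff)
  ultimately show ?thesis
    by (metis mult_right_cancel)
qed

definition comps_sum :: "nat \<Rightarrow> nat \<Rightarrow> int poly poly poly" where
  "comps_sum n m = (\<Sum>ks\<in>comps n m. qmultinomial Xq n ks * Xr ^ (ks ! 0)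
     * (\<Prod>i = 1..m. Xt * Xq * qint (Xt * Xq) (ks ! i - 1)))"

lemma comps_sum_0: "comps_sum n 0 = Xr ^ n"
proof -
  have "comps n 0 = {[n]}"
    by (auto simp: comps_def length_Suc_conv)
  then show ?thesis
    by (simp add: comps_sum_def qmultinomial_singleton)
qed

text \<open>
  Split off the last part \<open>n - k\<close> of a composition of \<open>n\<close>.
\<close>

lemma comps_sum_Suc:
  "comps_sum n (Suc m) = (\<Sum>k | k + 2 \<le> n. qbinomial Xq n k * comps_sum k m
     * (Xt * Xq * qint (Xt * Xq) (n - k - 1)))"
proof -
  let ?c = "\<lambda>j. Xt * Xq * qint (Xt * Xq) (j - 1)"
  let ?f = "\<lambda>n m ks. qmultinomial Xq n ks * Xr ^ (ks ! 0) * (\<Prod>i = 1..m. ?c (ks ! i))"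
  have "(\<Sum>k | k + 2 \<le> n. qbinomial Xq n k * comps_sum k m * ?c (n - k)) =
      (\<Sum>k | k + 2 \<le> n. \<Sum>ks\<in>comps k m. qbinomial Xq n k * ?f k m ks * ?c (n - k))"
    by (simp add: comps_sum_def sum_distrib_left sum_distrib_right)
  also have "\<dots> = (\<Sum>(k, ks)\<in>Sigma {k. k + 2 \<le> n} (\<lambda>k. comps k m). qbinomial Xq n k * ?f k m ks * ?c (n - k))"
    by (rule sum.Sigma) (auto simp: finite_comps intro: finite_subset[of _ "{..n}"])
  also have "\<dots> = (\<Sum>ks\<in>comps n (Suc m). ?f n (Suc m) ks)"
  proof (rule sum.reindex_bij_witness[where i = "\<lambda>ks. (n - last ks, butlast ks)" and j = "\<lambda>(k, ks). ks @ [n - k]"])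
    fix ks assume "ks \<in> comps n (Suc m)"
    then have ks: "length ks = Suc (Suc m)" "\<forall>i\<in>{1..Suc m}. ks ! i \<ge> 2" "sum_list ks = n"
      by (auto simp: comps_def)
    then obtain ks' j where snoc: "ks = ks' @ [j]"
      by (cases ks rule: rev_cases) auto
    show "(case (n - last ks, butlast ks) of (k, ks) \<Rightarrow> ks @ [n - k]) = ks"
      using ks snoc by simp
    have "j \<ge> 2"
      using ks snoc by (auto simp: nth_append dest!: bspec[of _ _ "Suc m"])
    moreover have "\<forall>i\<in>{1..m}. ks' ! i \<ge> 2"
    proof
      fix i assume "i \<in> {1..m}"
      then show "ks' ! i \<ge> 2"
        using ks snoc by (auto simp: nth_append dest!: bspec[of _ _ i])
    qed
    ultimately show "(n - last ks, butlast ks) \<in> Sigma {k. k + 2 \<le> n} (\<lambda>k. comps k m)"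
      using ks snoc by (auto simp: comps_def)
  next
    fix p assume "p \<in> Sigma {k. k + 2 \<le> n} (\<lambda>k. comps k m)"
    then obtain k ks where p: "p = (k, ks)" and k: "k + 2 \<le> n" and "ks \<in> comps k m"
      by auto
    then have ks: "length ks = Suc m" "\<forall>i\<in>{1..m}. ks ! i \<ge> 2" "sum_list ks = k"
      by (auto simp: comps_def)
    show "(\<lambda>ks. (n - last ks, butlast ks)) (case p of (k, ks) \<Rightarrow> ks @ [n - k]) = p"
      using k by (simp add: p)
    show "(case p of (k, ks) \<Rightarrow> ks @ [n - k]) \<in> comps n (Suc m)"
      using k ks by (auto simp: p comps_def nth_append)
    have "(\<Prod>i = 1..Suc m. ?c ((ks @ [n - k]) ! i)) = (\<Prod>i = 1..m. ?c (ks ! i)) * ?c (n - k)"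
      using ks by (simp add: prod.nat_ivl_Suc' nth_append mult.commute)
    moreover have "qmultinomial Xq n (ks @ [n - k]) = qbinomial Xq n k * qmultinomial Xq k ks"
      using qmultinomial_snoc[OF ks(3), of "n - k"] k by simp
    moreover have "(ks @ [n - k]) ! 0 = ks ! 0"
      using ks by (simp add: nth_append)
    ultimately have "?f n (Suc m) (ks @ [n - k]) = qbinomial Xq n k * ?f k m ks * ?c (n - k)"
      by (simp only: mult_ac)
    then show "?f n (Suc m) (case p of (k, ks) \<Rightarrow> ks @ [n - k]) =
        (case p of (k, ks) \<Rightarrow> qbinomial Xq n k * ?f k m ks * ?c (n - k))"
      by (simp only: p prod.case)
  qed
  finally show ?thesis
    by (simp only: comps_sum_def)
qed

lemma comps_sum_eq_0: "n < 2 * m \<Longrightarrow> comps_sum n m = 0"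
proof (induction m arbitrary: n)
  case (Suc m)
  then show ?case
    by (auto simp: comps_sum_Suc intro!: sum.neutral)
qed simp

text \<open>
  The sum over \<open>m\<close> obeys the recurrence of \<open>A_maj_exc_fix\<close>. The bound \<open>n div 2\<close> may be
  replaced by any larger one because \<open>m\<close> parts of size at least two do not fit into
  a number less than \<open>2 * m\<close>; this lets all \<open>k < n\<close> share the range \<open>m < n\<close>.
\<close>

lemma A_maj_exc_fix_eq_comps_sum: "A_maj_exc_fix n Xq Xt Xr = (\<Sum>m = 0..n div 2. comps_sum n m)"
proof (induction n rule: less_induct)
  case (less n)
  have extend: "(\<Sum>m = 0..k div 2. comps_sum k m) = (\<Sum>m<M. comps_sum k m)" if "k < M" for k M
    by (rule sum.mono_neutral_left) (use that comps_sum_eq_0 in auto)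
  have "(\<Sum>m = 0..n div 2. comps_sum n m) = (\<Sum>m<Suc n. comps_sum n m)"
    by (rule extend) simp
  also have "\<dots> = Xr ^ n + (\<Sum>m<n. comps_sum n (Suc m))"
    by (simp only: sum.lessThan_Suc_shift comps_sum_0)
  also have "(\<Sum>m<n. comps_sum n (Suc m)) =
      (\<Sum>k | k + 2 \<le> n. qbinomial Xq n k * (\<Sum>m<n. comps_sum k m) * (Xt * Xq * qint (Xt * Xq) (n - k - 1)))"
    unfolding comps_sum_Suc by (subst sum.swap) (simp only: sum_distrib_left sum_distrib_right)
  also have "\<dots> = (\<Sum>k | k + 2 \<le> n. qbinomial Xq n k * A_maj_exc_fix k Xq Xt Xr
      * (Xt * Xq * qint (Xt * Xq) (n - k - 1)))"
    by (intro sum.cong refl) (use less.IH extend in simp)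
  finally show ?case
    unfolding A_maj_exc_fix_recurrence[of n] ..
qed

theorem corollary4p3:
  fixes n :: nat
  shows "A_maj_exc_fix n Xq Xt Xr =
           Xr ^ n + (\<Sum>k\<in>{k. k + 2 \<le> n}. qbinomial Xq n k * A_maj_exc_fix k Xq Xt Xr
                                          * (Xt * Xq * qint (Xt * Xq) (n - k - 1)))
       \<and> A_maj_exc_fix n Xq Xt Xr =
           (\<Sum>m = 0..n div 2. \<Sum>ks\<in>comps n m. qmultinomial Xq n ks * Xr ^ (ks ! 0)
              * (\<Prod>i = 1..m. Xt * Xq * qint (Xt * Xq) (ks ! i - 1)))"
  using A_maj_exc_fix_recurrence[of n] A_maj_exc_fix_eq_comps_sum[of n]
  unfolding comps_sum_def by blast

end
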